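(* Let $2<h<4$ and let $\zeta=(\zeta_t)_{t\ge0}$ be the negative sub-fractional Brownian motion with parameter $h$, i.e. the centered Gaussian process with covariance $$E\zeta_s\zeta_t=(2-h)\left(s^h+t^h-\frac12\left[(s+t)^h+|s-t|^h\right]\right),\qquad s,t\ge 0.$$ Then $\zeta$ has the following properties. (1) $\zeta$ has continuously differentiable paths, hence it is a semimartingale. (2) Self-similarity: for each $c>0$, $(\zeta_{ct})_{t\ge0}\stackrel{d}{=}(c^{h/2}\zeta_t)_{t\ge0}$. (3) Second moments of increments: for every $T>0$ there is a constant $C=C(T)<\infty$ such that $E(\zeta_t-\zeta_s)^2\le C|t-s|^2$ for all $0\le s<t\le T$; for every $\varepsilon>0$ there is a constant $C=C(\varepsilon)>0$ such that $E(\zeta_t-\zeta_s)^2\ge C|t-s|^2$ for all $\varepsilon\le s<t$; and there is a constant $C>0$ such that $E(\zeta_t-\zeta_s)^2\ge C|t-s|^h$ for all $s,t\ge 0$. (4) Positive correlation of increments: for $0\le r<v$ and $0\le s<t$, $$E\big((\zeta_v-\zeta_r)(\zeta_t-\zeta_s)\big)>0.$$ (5) Long-range dependence: for $0\le r<v\le s<t$, $$\lim_{T\to\infty}T^{3-h}E\big((\zeta_v-\zeta_r)(\zeta_{t+T}-\zeta_{s+T})\big)=\frac{h(h-1)(h-2)^2}{2}(t-s)(v^2-r^2).$$ (6) $\zeta$ is not a Markov process.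
   Context: The stated covariance function is positive-definite for $2<h<4$, and the process $\zeta$ is taken in the version $\zeta_t=\left(\frac12h(h-1)(h-2)\right)^{1/2}\int_0^t\vartheta_s\,ds$, where $\vartheta$ is a centered Gaussian process with continuous paths and covariance $(s+t)^{h-2}-|s-t|^{h-2}$. Here $\stackrel{d}{=}$ denotes equality of finite-dimensional distributions. The semimartingale and Markov properties are understood with respect to the natural filtration of the process. *)

theory Defs
  imports "HOL-Probability.Probability"
begin

text \<open>
  A real-valued process on a probability space \<open>M\<close> is a function \<open>X :: real \<Rightarrow> 'a \<Rightarrow> real\<close> of which
  only the values \<open>X t\<close> with \<open>t \<ge> 0\<close> matter.
\<close>

text \<open>Constants count as (degenerate) Gaussian random variables.\<close>

definition gaussian_rv :: "'a measure \<Rightarrow> ('a \<Rightarrow> real) \<Rightarrow> bool" where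
  "gaussian_rv M Y \<longleftrightarrow> Y \<in> borel_measurable M \<and>
     ((\<exists>\<mu>. AE \<omega> in M. Y \<omega> = \<mu>) \<or>
      (\<exists>\<mu> \<sigma>. 0 < \<sigma> \<and> distributed M lborel Y (normal_density \<mu> \<sigma>)))"

definition centered_gaussian_process :: "'a measure \<Rightarrow> (real \<Rightarrow> 'a \<Rightarrow> real) \<Rightarrow> bool" where
  "centered_gaussian_process M X \<longleftrightarrow>
     (\<forall>J a. finite J \<and> J \<subseteq> {0..} \<longrightarrow> gaussian_rv M (\<lambda>\<omega>. \<Sum>t\<in>J. a t * X t \<omega>)) \<and>
     (\<forall>t\<ge>0. (\<integral>\<omega>. X t \<omega> \<partial>M) = 0)"

definition has_covariance ::
  "'a measure \<Rightarrow> (real \<Rightarrow> 'a \<Rightarrow> real) \<Rightarrow> (real \<Rightarrow> real \<Rightarrow> real) \<Rightarrow> bool" where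
  "has_covariance M X K \<longleftrightarrow> (\<forall>s\<ge>0. \<forall>t\<ge>0. (\<integral>\<omega>. X s \<omega> * X t \<omega> \<partial>M) = K s t)"

definition neg_sub_fBm :: "'a measure \<Rightarrow> real \<Rightarrow> (real \<Rightarrow> 'a \<Rightarrow> real) \<Rightarrow> bool" where
  "neg_sub_fBm M h \<zeta> \<longleftrightarrow> centered_gaussian_process M \<zeta> \<and>
     has_covariance M \<zeta> (\<lambda>s t. (2 - h) *
       (s powr h + t powr h - 1 / 2 * ((s + t) powr h + \<bar>s - t\<bar> powr h)))"

definition fdd_eq ::
  "'a measure \<Rightarrow> (real \<Rightarrow> 'a \<Rightarrow> real) \<Rightarrow> 'b measure \<Rightarrow> (real \<Rightarrow> 'b \<Rightarrow> real) \<Rightarrow> bool" where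
  "fdd_eq M X N Y \<longleftrightarrow> (\<forall>J. finite J \<and> J \<subseteq> {0..} \<longrightarrow>
     distr M (Pi\<^sub>M J (\<lambda>_. borel)) (\<lambda>\<omega>. \<lambda>t\<in>J. X t \<omega>) =
     distr N (Pi\<^sub>M J (\<lambda>_. borel)) (\<lambda>\<omega>. \<lambda>t\<in>J. Y t \<omega>))"

text \<open>Derivatives and continuity at \<open>0\<close> are one-sided.\<close>

definition continuously_differentiable_path :: "(real \<Rightarrow> real) \<Rightarrow> bool" where
  "continuously_differentiable_path f \<longleftrightarrow>
     (\<exists>f'. continuous_on {0..} f' \<and>
           (\<forall>t\<ge>0. (f has_real_derivative f' t) (at t within {0..})))"

definition cadlag :: "(real \<Rightarrow> real) \<Rightarrow> bool" where
  "cadlag f \<longleftrightarrow> (\<forall>t\<ge>0. (f \<longlongrightarrow> f t) (at_right t)) \<and> (\<forall>t>0. \<exists>l. (f \<longlongrightarrow> l) (at_left t))"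

definition locally_finite_variation :: "(real \<Rightarrow> real) \<Rightarrow> bool" where
  "locally_finite_variation f \<longleftrightarrow>
     (\<forall>T\<ge>0. \<exists>B. \<forall>(n::nat) p. mono p \<and> range p \<subseteq> {0..T} \<longrightarrow>
        (\<Sum>i<n. \<bar>f (p (Suc i)) - f (p i)\<bar>) \<le> B)"

definition natural_filtration ::
  "'a measure \<Rightarrow> (real \<Rightarrow> 'a \<Rightarrow> real) \<Rightarrow> real \<Rightarrow> 'a measure" where
  "natural_filtration M X t =
     sigma (space M) (\<Union>s\<in>{0..t}. {X s -` B \<inter> space M | B. B \<in> sets borel})"

definition filtration_on :: "'a measure \<Rightarrow> (real \<Rightarrow> 'a measure) \<Rightarrow> bool" where
  "filtration_on M F \<longleftrightarrow> filtration (space M) F \<and> (\<forall>t. subalgebra M (F t))"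

definition adapted :: "(real \<Rightarrow> 'a measure) \<Rightarrow> (real \<Rightarrow> 'a \<Rightarrow> real) \<Rightarrow> bool" where
  "adapted F X \<longleftrightarrow> (\<forall>t\<ge>0. X t \<in> borel_measurable (F t))"

definition martingale ::
  "'a measure \<Rightarrow> (real \<Rightarrow> 'a measure) \<Rightarrow> (real \<Rightarrow> 'a \<Rightarrow> real) \<Rightarrow> bool" where
  "martingale M F X \<longleftrightarrow> adapted F X \<and> (\<forall>t\<ge>0. integrable M (X t)) \<and>
     (\<forall>s t. 0 \<le> s \<and> s \<le> t \<longrightarrow> (AE \<omega> in M. real_cond_exp M (F s) (X t) \<omega> = X s \<omega>))"

text \<open>
  A \<open>[0,\<infinity>]\<close>-valued stopping time is expressed by the library notion with time set \<^typ>\<open>ennreal\<close>;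
  its condition at time \<open>\<infinity>\<close> is vacuous.
\<close>

definition stopping_time_ext :: "(real \<Rightarrow> 'a measure) \<Rightarrow> ('a \<Rightarrow> ennreal) \<Rightarrow> bool" where
  "stopping_time_ext F \<tau> \<longleftrightarrow> stopping_time (\<lambda>t. F (enn2real t)) \<tau>"

definition stopped ::
  "(real \<Rightarrow> 'a \<Rightarrow> real) \<Rightarrow> ('a \<Rightarrow> ennreal) \<Rightarrow> real \<Rightarrow> 'a \<Rightarrow> real" where
  "stopped X \<tau> t \<omega> = X (enn2real (min (ennreal t) (\<tau> \<omega>))) \<omega>"

definition local_martingale ::
  "'a measure \<Rightarrow> (real \<Rightarrow> 'a measure) \<Rightarrow> (real \<Rightarrow> 'a \<Rightarrow> real) \<Rightarrow> bool" where
  "local_martingale M F X \<longleftrightarrow> adapted F X \<and> (\<forall>\<omega>\<in>space M. cadlag (\<lambda>t. X t \<omega>)) \<and>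
     (\<exists>\<tau> :: nat \<Rightarrow> 'a \<Rightarrow> ennreal.
        (\<forall>n. stopping_time_ext F (\<tau> n)) \<and>
        (AE \<omega> in M. incseq (\<lambda>n. \<tau> n \<omega>) \<and> (\<lambda>n. \<tau> n \<omega>) \<longlonglongrightarrow> \<infinity>) \<and>
        (\<forall>n. martingale M F (\<lambda>t \<omega>. stopped X (\<tau> n) t \<omega> - X 0 \<omega>)))"

definition semimartingale ::
  "'a measure \<Rightarrow> (real \<Rightarrow> 'a measure) \<Rightarrow> (real \<Rightarrow> 'a \<Rightarrow> real) \<Rightarrow> bool" where
  "semimartingale M F X \<longleftrightarrow> filtration_on M F \<and> adapted F X \<and>
     (\<exists>N A. local_martingale M F N \<and>
        adapted F A \<and> (\<forall>\<omega>\<in>space M. cadlag (\<lambda>t. A t \<omega>) \<and> locally_finite_variation (\<lambda>t. A t \<omega>)) \<and>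
        (\<forall>\<omega>\<in>space M. N 0 \<omega> = 0 \<and> A 0 \<omega> = 0 \<and> (\<forall>t\<ge>0. X t \<omega> = X 0 \<omega> + N t \<omega> + A t \<omega>)))"

definition markov_process ::
  "'a measure \<Rightarrow> (real \<Rightarrow> 'a measure) \<Rightarrow> (real \<Rightarrow> 'a \<Rightarrow> real) \<Rightarrow> bool" where
  "markov_process M F X \<longleftrightarrow> filtration_on M F \<and> adapted F X \<and>
     (\<forall>s t B. 0 \<le> s \<and> s \<le> t \<and> B \<in> sets borel \<longrightarrow>
        (AE \<omega> in M. real_cond_exp M (F s) (indicator (X t -` B \<inter> space M)) \<omega> =
                    real_cond_exp M (vimage_algebra (space M) (X s) borel)
                      (indicator (X t -` B \<inter> space M)) \<omega>))"

end

theory Submission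
  imports Defs "HOL-Real_Asymp.Real_Asymp"
begin

text \<open>
  Up to the factor \<open>h - 2\<close> the covariance is \<open>R(s, t) = Q(s, t) / 2 - s\<^sup>h - t\<^sup>h\<close> with
  \<open>Q(a, b) = (a + b)\<^sup>h + \<bar>a - b\<bar>\<^sup>h\<close>, and the variance of the increment over \<open>[s, t]\<close> is
  \<open>R(s + t, t - s)\<close>. The mixed derivative of \<open>Q\<close> is positive, which gives the positive correlation of
  increments and, since \<open>R(m, d)\<close> is half a mixed difference of \<open>Q\<close> over \<open>[0, m] \<times> [0, d]\<close>, its
  monotonicity in \<open>m\<close>; the variance bounds follow from this and from second-order estimates, and
  long-range dependence from a third-order expansion at infinity. Self-similarity holds because linear
  combinations determine the joint law. A Markovian Gaussian process satisfies
  \<open>R(r, t) R(s, s) = R(r, s) R(s, t)\<close> for \<open>r \<le> s \<le> t\<close>, which \<open>R\<close> does not.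
\<close>

section \<open>Laws determined by trigonometric test functions\<close>

text \<open>A Gaussian process is given through single linear combinations, so joint laws have to be
  rebuilt from laws on the line. The other coordinates enter through a nonnegative weight, and
  Levy's uniqueness theorem is applied to the law of one coordinate under that weight. The result
  serves twice: for self-similarity, and for turning zero correlation into orthogonality to all
  events of one variable, which is as much independence as the Markov argument consumes.

  The mixed derivative of (h - 2) R is h (h - 1) (h - 2) / 2 times the covariance of \<theta>; this
  is the origin of the constant under the square root. The powers carry absolute values so that, for
  h > 2, Q can be differentiated twice across a = b without case distinctions. The bound h < 4 is
  essential to the failure of the Markov property: at h = 4 one has R(s, t) = 6 s^2 t^2, which
  satisfies the product identity.\<close>

lemma weighted_law:
  fixes X W :: "'a \<Rightarrow> real"
  assumes X [measurable]: "X \<in> borel_measurable M" and W: "integrable M W"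
    and nn: "\<And>\<omega>. 0 \<le> W \<omega>" and pos: "0 < (\<integral>\<omega>. W \<omega> \<partial>M)"
  defines "m \<equiv> \<integral>\<omega>. W \<omega> \<partial>M"
  defines "\<mu> \<equiv> distr (density M (\<lambda>\<omega>. ennreal (W \<omega> / m))) borel X"
  shows "real_distribution \<mu>"
    and "char \<mu> u = complex_of_real ((\<integral>\<omega>. W \<omega> * cos (u * X \<omega> + 0) \<partial>M) / m)
           + \<i> * complex_of_real ((\<integral>\<omega>. W \<omega> * cos (u * X \<omega> + - (pi / 2)) \<partial>M) / m)"
    and "B \<in> sets borel \<Longrightarrow> measure \<mu> B = (\<integral>\<omega>. W \<omega> * indicator B (X \<omega>) \<partial>M) / m"
proof -
  have [measurable]: "W \<in> borel_measurable M" using W by auto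
  have m: "m > 0" using pos by (simp add: m_def)
  have int: "integral\<^sup>L \<mu> f = (\<integral>\<omega>. (W \<omega> / m) *\<^sub>R f (X \<omega>) \<partial>M)" if [measurable]: "f \<in> borel_measurable borel"
    for f :: "real \<Rightarrow> 'b :: {banach, second_countable_topology}"
    unfolding \<mu>_def using nn m
    by (simp add: integral_distr integral_density)
  \<comment> \<open>Levy's theorem concerns probability laws, hence the division by the total mass
    \<open>m\<close>.\<close>
  have "emeasure (density M (\<lambda>\<omega>. ennreal (W \<omega> / m))) (space M) = (\<integral>\<^sup>+ \<omega>. ennreal (W \<omega> / m) \<partial>M)"
    by (simp add: emeasure_density)
  also have "\<dots> = ennreal (\<integral>\<omega>. W \<omega> / m \<partial>M)"
    using W nn m by (intro nn_integral_eq_integral) auto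
  also have "\<dots> = 1" using m by (simp add: m_def)
  finally have "prob_space (density M (\<lambda>\<omega>. ennreal (W \<omega> / m)))"
    by (intro prob_spaceI) simp
  then interpret D: prob_space "density M (\<lambda>\<omega>. ennreal (W \<omega> / m))" .
  show rd: "real_distribution \<mu>"
    unfolding \<mu>_def by (intro D.real_distribution_distr) auto
  interpret real_distribution \<mu> by (rule rd)
  show "measure \<mu> B = (\<integral>\<omega>. W \<omega> * indicator B (X \<omega>) \<partial>M) / m" if [measurable]: "B \<in> sets borel"
    using int[of "indicator B :: real \<Rightarrow> real"] by simp
  have I: "integrable M (\<lambda>\<omega>. complex_of_real (W \<omega>) * iexp (u * X \<omega>))"
    by (rule Bochner_Integration.integrable_bound[OF W]) (auto simp: norm_mult)
  have "char \<mu> u = (\<integral>\<omega>. complex_of_real (W \<omega>) * iexp (u * X \<omega>) / of_real m \<partial>M)"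
    unfolding char_def by (subst int) (auto simp: scaleR_conv_of_real field_simps)
  also have "\<dots> = (\<integral>\<omega>. complex_of_real (W \<omega>) * iexp (u * X \<omega>) \<partial>M) / of_real m"
    by simp
  finally have c: "char \<mu> u = (\<integral>\<omega>. complex_of_real (W \<omega>) * iexp (u * X \<omega>) \<partial>M) / of_real m" .
  have "Re (char \<mu> u) = (\<integral>\<omega>. W \<omega> * cos (u * X \<omega>) \<partial>M) / m"
    unfolding c using integral_Re[OF I] by (simp add: Re_exp)
  moreover have "Im (char \<mu> u) = (\<integral>\<omega>. W \<omega> * sin (u * X \<omega>) \<partial>M) / m"
    unfolding c using integral_Im[OF I] by (simp add: Im_exp)
  \<comment> \<open>Cosines with a free phase encode both real and imaginary part, so all test
    functions can stay real.\<close>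
  moreover have "cos (u * X \<omega> + - (pi / 2)) = sin (u * X \<omega>)" for \<omega>
    by (simp add: cos_diff)
  ultimately show "char \<mu> u = complex_of_real ((\<integral>\<omega>. W \<omega> * cos (u * X \<omega> + 0) \<partial>M) / m)
           + \<i> * complex_of_real ((\<integral>\<omega>. W \<omega> * cos (u * X \<omega> + - (pi / 2)) \<partial>M) / m)"
    by (intro complex_eqI) simp_all
qed

text \<open>Taking u = c = 0 shows that the two weights have equal mass; after normalisation the
  weighted laws have the same characteristic function. Mass zero cannot be normalised, but then both
  weights vanish almost everywhere.\<close>

lemma weighted_Levy_uniqueness:
  fixes X W :: "'a \<Rightarrow> real" and Y V :: "'b \<Rightarrow> real"
  assumes [measurable]: "X \<in> borel_measurable M" "Y \<in> borel_measurable N"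
    and W: "integrable M W" "\<And>\<omega>. 0 \<le> W \<omega>" and V: "integrable N V" "\<And>\<omega>. 0 \<le> V \<omega>"
    and eq: "\<And>u c. (\<integral>\<omega>. W \<omega> * cos (u * X \<omega> + c) \<partial>M) = (\<integral>\<omega>. V \<omega> * cos (u * Y \<omega> + c) \<partial>N)"
    and B: "B \<in> sets borel"
  shows "(\<integral>\<omega>. W \<omega> * indicator B (X \<omega>) \<partial>M) = (\<integral>\<omega>. V \<omega> * indicator B (Y \<omega>) \<partial>N)"
proof -
  have m: "(\<integral>\<omega>. W \<omega> \<partial>M) = (\<integral>\<omega>. V \<omega> \<partial>N)"
    using eq[of 0 0] by simp
  consider "(\<integral>\<omega>. W \<omega> \<partial>M) = 0" | "0 < (\<integral>\<omega>. W \<omega> \<partial>M)"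
    using Bochner_Integration.integral_nonneg[of M W] W(2) by fastforce
  then show ?thesis
  proof cases
    case 1
    then have "AE \<omega> in M. W \<omega> = 0" "AE \<omega> in N. V \<omega> = 0"
      using m W V integral_nonneg_eq_0_iff_AE[of M W] integral_nonneg_eq_0_iff_AE[of N V] by auto
    then have "AE \<omega> in M. W \<omega> * indicator B (X \<omega>) = 0" "AE \<omega> in N. V \<omega> * indicator B (Y \<omega>) = 0"
      by auto
    then show ?thesis by (simp add: integral_eq_zero_AE)
  next
    case 2
    note P = weighted_law[OF assms(1) W 2] weighted_law[OF assms(2) V 2[unfolded m]]
    have "distr (density M (\<lambda>\<omega>. ennreal (W \<omega> / integral\<^sup>L M W))) borel X
        = distr (density N (\<lambda>\<omega>. ennreal (V \<omega> / integral\<^sup>L N V))) borel Y"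
      by (rule Levy_uniqueness[OF P(1,4)], rule ext) (simp only: P(2,5) eq, simp only: m)
    then show ?thesis
      using P(3)[OF B] P(6)[OF B] 2 m by simp
  qed
qed

text \<open>Product-to-sum formula that turns the auxiliary weight 1 + cos back into pure cosines,
  about which the hypotheses speak.\<close>

lemma weighted_cos_product:
  fixes w :: real
  shows "w * (1 + cos p) * cos q = w * cos q + (w * cos (q + p) + w * cos (q - p)) / 2"
  by (simp add: cos_add cos_diff field_simps)

text \<open>The weight \<open>1 + cos\<close> is nonnegative, so that one coordinate at a time can be passed
  from trigonometric to indicator test functions.\<close>

lemma swap_coordinate:
  fixes X :: "'i \<Rightarrow> 'a \<Rightarrow> real" and Y :: "'i \<Rightarrow> 'b \<Rightarrow> real"
  assumes J: "finite J" "k \<in> J"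
    and X [measurable]: "\<And>t. t \<in> J \<Longrightarrow> X t \<in> borel_measurable M"
    and Y [measurable]: "\<And>t. t \<in> J \<Longrightarrow> Y t \<in> borel_measurable N"
    and W: "integrable M W" "\<And>\<omega>. 0 \<le> W \<omega>" and V: "integrable N V" "\<And>\<omega>. 0 \<le> V \<omega>"
    and eq: "\<And>a b. (\<integral>\<omega>. W \<omega> * cos ((\<Sum>t\<in>J. a t * X t \<omega>) + b) \<partial>M)
                  = (\<integral>\<omega>. V \<omega> * cos ((\<Sum>t\<in>J. a t * Y t \<omega>) + b) \<partial>N)"
    and B: "B \<in> sets borel"
  shows "(\<integral>\<omega>. W \<omega> * indicator B (X k \<omega>) * cos ((\<Sum>t\<in>J. a t * X t \<omega>) + b) \<partial>M)
       = (\<integral>\<omega>. V \<omega> * indicator B (Y k \<omega>) * cos ((\<Sum>t\<in>J. a t * Y t \<omega>) + b) \<partial>N)"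
proof -
  note [measurable] = B
  define S where "S a \<omega> = (\<Sum>t\<in>J. a t * X t \<omega>)" for a \<omega>
  define S' where "S' a \<omega> = (\<Sum>t\<in>J. a t * Y t \<omega>)" for a \<omega>
  have [measurable]: "S a \<in> borel_measurable M" "S' a \<in> borel_measurable N" for a
    unfolding S_def S'_def by measurable
  have [measurable]: "W \<in> borel_measurable M" "V \<in> borel_measurable N"
    using W V by auto
  have [measurable]: "X k \<in> borel_measurable M" "Y k \<in> borel_measurable N"
    using J X Y by auto
  have i1: "integrable M (\<lambda>\<omega>. W \<omega> * f \<omega>)" if "f \<in> borel_measurable M" "\<And>\<omega>. \<bar>f \<omega>\<bar> \<le> 2" for f
    by (rule Bochner_Integration.integrable_bound[OF integrable_mult_left[OF W(1), of 2]])
       (use that W in \<open>auto simp: abs_mult intro!: mult_left_mono\<close>)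
  have i2: "integrable N (\<lambda>\<omega>. V \<omega> * f \<omega>)" if "f \<in> borel_measurable N" "\<And>\<omega>. \<bar>f \<omega>\<bar> \<le> 2" for f
    by (rule Bochner_Integration.integrable_bound[OF integrable_mult_left[OF V(1), of 2]])
       (use that V in \<open>auto simp: abs_mult intro!: mult_left_mono\<close>)
  have c2: "\<bar>cos x\<bar> \<le> 2" "\<bar>1 + cos x\<bar> \<le> 2" for x :: real
    using abs_cos_le_one[of x] by linarith+
  \<comment> \<open>Adding a multiple of one coordinate only changes its coefficient, so linear
    combinations are closed under the shifts that the product formula produces.\<close>
  have add: "u * X k \<omega> + S a \<omega> = S (a(k := a k + u)) \<omega>" "u * Y k \<omega>' + S' a \<omega>' = S' (a(k := a k + u)) \<omega>'" for u a \<omega> \<omega>'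
    unfolding S_def S'_def using J by (simp_all add: sum.remove[of J k] algebra_simps)
  have S1: "u * X k \<omega> + c = S ((\<lambda>_. 0)(k := u)) \<omega> + c" "u * Y k \<omega>' + c = S' ((\<lambda>_. 0)(k := u)) \<omega>' + c" for u c \<omega> \<omega>'
    unfolding S_def S'_def using J by (simp_all add: sum.remove[of J k])
  have "S (a(k := a k - u)) \<omega> + (b - c) = - (u * X k \<omega> + c - (S a \<omega> + b))"
     "S' (a(k := a k - u)) \<omega>' + (b - c) = - (u * Y k \<omega>' + c - (S' a \<omega>' + b))" for u c a b \<omega> \<omega>'
    using add[of "- u"] by simp_all
  then have sgn: "cos (u * X k \<omega> + c - (S a \<omega> + b)) = cos (S (a(k := a k - u)) \<omega> + (b - c))"
     "cos (u * Y k \<omega>' + c - (S' a \<omega>' + b)) = cos (S' (a(k := a k - u)) \<omega>' + (b - c))" for u c a b \<omega> \<omega>'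
    by (simp_all only: cos_minus)
  have "u * X k \<omega> + c + (S a \<omega> + b) = S (a(k := a k + u)) \<omega> + (b + c)"
     "u * Y k \<omega>' + c + (S' a \<omega>' + b) = S' (a(k := a k + u)) \<omega>' + (b + c)" for u c a b \<omega> \<omega>'
    using add[of u] by simp_all
  then have sm: "cos (u * X k \<omega> + c + (S a \<omega> + b)) = cos (S (a(k := a k + u)) \<omega> + (b + c))"
     "cos (u * Y k \<omega>' + c + (S' a \<omega>' + b)) = cos (S' (a(k := a k + u)) \<omega>' + (b + c))" for u c a b \<omega> \<omega>'
    by (simp_all only:)
  have E: "(\<integral>\<omega>. W \<omega> * cos (S a \<omega> + b) \<partial>M) = (\<integral>\<omega>. V \<omega> * cos (S' a \<omega> + b) \<partial>N)" for a b
    using eq by (simp add: S_def S'_def)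
  \<comment> \<open>Levy uniqueness for coordinate \<open>k\<close> alone, with the remaining cosine
    hidden in the weight. Its hypothesis splits into three cosine integrals, each covered by
    \<open>E\<close>.\<close>
  have weighted: "(\<integral>\<omega>. (W \<omega> * (1 + cos (S a \<omega> + b))) * indicator B (X k \<omega>) \<partial>M)
      = (\<integral>\<omega>. (V \<omega> * (1 + cos (S' a \<omega> + b))) * indicator B (Y k \<omega>) \<partial>N)" for a b
  proof (rule weighted_Levy_uniqueness)
    fix u c
    let ?a1 = "(\<lambda>_. 0)(k := u)" and ?a2 = "a(k := a k + u)" and ?a3 = "a(k := a k - u)"
    have "(\<integral>\<omega>. (W \<omega> * (1 + cos (S a \<omega> + b))) * cos (u * X k \<omega> + c) \<partial>M)
        = (\<integral>\<omega>. W \<omega> * cos (S ?a1 \<omega> + c) + (W \<omega> * cos (S ?a2 \<omega> + (b + c)) + W \<omega> * cos (S ?a3 \<omega> + (b - c))) / 2 \<partial>M)"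
      by (unfold weighted_cos_product, unfold sm(1) sgn(1), unfold S1(1)) (rule refl)
    also have "\<dots> = (\<integral>\<omega>. W \<omega> * cos (S ?a1 \<omega> + c) \<partial>M) + ((\<integral>\<omega>. W \<omega> * cos (S ?a2 \<omega> + (b + c)) \<partial>M)
        + (\<integral>\<omega>. W \<omega> * cos (S ?a3 \<omega> + (b - c)) \<partial>M)) / 2"
      by (simp add: i1 c2 del: fun_upd_apply)
    also have "\<dots> = (\<integral>\<omega>. V \<omega> * cos (S' ?a1 \<omega> + c) \<partial>N) + ((\<integral>\<omega>. V \<omega> * cos (S' ?a2 \<omega> + (b + c)) \<partial>N)
        + (\<integral>\<omega>. V \<omega> * cos (S' ?a3 \<omega> + (b - c)) \<partial>N)) / 2"
      by (simp only: E)
    also have "\<dots> = (\<integral>\<omega>. V \<omega> * cos (S' ?a1 \<omega> + c) + (V \<omega> * cos (S' ?a2 \<omega> + (b + c)) + V \<omega> * cos (S' ?a3 \<omega> + (b - c))) / 2 \<partial>N)"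
      by (simp add: i2 c2 del: fun_upd_apply)
    also have "\<dots> = (\<integral>\<omega>. (V \<omega> * (1 + cos (S' a \<omega> + b))) * cos (u * Y k \<omega> + c) \<partial>N)"
      by (unfold weighted_cos_product, unfold sm(2) sgn(2), unfold S1(2)) (rule refl)
    finally show "(\<integral>\<omega>. (W \<omega> * (1 + cos (S a \<omega> + b))) * cos (u * X k \<omega> + c) \<partial>M)
        = (\<integral>\<omega>. (V \<omega> * (1 + cos (S' a \<omega> + b))) * cos (u * Y k \<omega> + c) \<partial>N)" .
  next
    have "0 \<le> 1 + cos x" for x :: real using cos_ge_minus_one[of x] by linarith
    then show "0 \<le> W \<omega> * (1 + cos (S a \<omega> + b))" "0 \<le> V \<omega>' * (1 + cos (S' a \<omega>' + b))" for \<omega> \<omega>'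
      using W V by auto
  qed (auto intro!: i1 i2 c2)
  have nul: "S (\<lambda>_. 0) \<omega> = 0" "S' (\<lambda>_. 0) \<omega>' = 0" for \<omega> \<omega>'
    by (simp_all add: S_def S'_def)
  \<comment> \<open>Zero coefficients and phase pi / 2 make the cosine vanish. This gives the share
    of the summand 1 in the weight; subtracting it from \<open>weighted\<close> leaves the
    cosine.\<close>
  have base: "(\<integral>\<omega>. W \<omega> * indicator B (X k \<omega>) \<partial>M) = (\<integral>\<omega>. V \<omega> * indicator B (Y k \<omega>) \<partial>N)"
    using weighted[of "\<lambda>_. 0" "pi / 2"] by (simp add: nul)
  have i3: "integrable M (\<lambda>\<omega>. W \<omega> * indicator B (X k \<omega>))" "integrable N (\<lambda>\<omega>. V \<omega> * indicator B (Y k \<omega>))"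
    by (auto intro!: i1 i2 simp: indicator_def)
  have ic: "\<bar>indicator B x * cos y\<bar> \<le> 2" for x y :: real
    using c2(1)[of y] by (simp add: indicator_def)
  have i4: "integrable M (\<lambda>\<omega>. W \<omega> * (indicator B (X k \<omega>) * cos (S a \<omega> + b)))"
     "integrable N (\<lambda>\<omega>. V \<omega> * (indicator B (Y k \<omega>) * cos (S' a \<omega> + b)))"
    by (rule i1 i2; use ic in simp; fail)+
  have "(\<integral>\<omega>. (W \<omega> * (1 + cos (S a \<omega> + b))) * indicator B (X k \<omega>) \<partial>M)
      = (\<integral>\<omega>. W \<omega> * indicator B (X k \<omega>) + W \<omega> * (indicator B (X k \<omega>) * cos (S a \<omega> + b)) \<partial>M)"
    by (simp add: algebra_simps)
  also have "\<dots> = (\<integral>\<omega>. W \<omega> * indicator B (X k \<omega>) \<partial>M) + (\<integral>\<omega>. W \<omega> * (indicator B (X k \<omega>) * cos (S a \<omega> + b)) \<partial>M)"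
    by (rule Bochner_Integration.integral_add[OF i3(1) i4(1)])
  finally have M: "(\<integral>\<omega>. (W \<omega> * (1 + cos (S a \<omega> + b))) * indicator B (X k \<omega>) \<partial>M) = \<dots>" .
  have "(\<integral>\<omega>. (V \<omega> * (1 + cos (S' a \<omega> + b))) * indicator B (Y k \<omega>) \<partial>N)
      = (\<integral>\<omega>. V \<omega> * indicator B (Y k \<omega>) + V \<omega> * (indicator B (Y k \<omega>) * cos (S' a \<omega> + b)) \<partial>N)"
    by (simp add: algebra_simps)
  also have "\<dots> = (\<integral>\<omega>. V \<omega> * indicator B (Y k \<omega>) \<partial>N) + (\<integral>\<omega>. V \<omega> * (indicator B (Y k \<omega>) * cos (S' a \<omega> + b)) \<partial>N)"
    by (rule Bochner_Integration.integral_add[OF i3(2) i4(2)])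
  finally have N: "(\<integral>\<omega>. (V \<omega> * (1 + cos (S' a \<omega> + b))) * indicator B (Y k \<omega>) \<partial>N) = \<dots>" .
  show ?thesis
    using M N base weighted[of a b] by (simp add: S_def S'_def mult.assoc)
qed

text \<open>Cosines are exchanged for indicators one coordinate at a time until the probabilities of
  boxes are reached; boxes are closed under intersection and generate the product
  sigma-algebra.\<close>

lemma Cramer_Wold:
  fixes X :: "'i \<Rightarrow> 'a \<Rightarrow> real" and Y :: "'i \<Rightarrow> 'b \<Rightarrow> real"
  assumes P: "prob_space M" "prob_space N" and J: "finite J"
    and X [measurable]: "\<And>t. t \<in> J \<Longrightarrow> X t \<in> borel_measurable M"
    and Y [measurable]: "\<And>t. t \<in> J \<Longrightarrow> Y t \<in> borel_measurable N"
    and eq: "\<And>a b. (\<integral>\<omega>. cos ((\<Sum>t\<in>J. a t * X t \<omega>) + b) \<partial>M) = (\<integral>\<omega>. cos ((\<Sum>t\<in>J. a t * Y t \<omega>) + b) \<partial>N)"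
  shows "distr M (Pi\<^sub>M J (\<lambda>_. borel)) (\<lambda>\<omega>. \<lambda>t\<in>J. X t \<omega>) = distr N (Pi\<^sub>M J (\<lambda>_. borel)) (\<lambda>\<omega>. \<lambda>t\<in>J. Y t \<omega>)"
proof -
  interpret M: prob_space M by (rule P)
  interpret N: prob_space N by (rule P)
  \<comment> \<open>\<open>A\<close> collects the coordinates already exchanged. The cosine keeps
    all of \<open>J\<close> with free coefficients, which is the form needed to exchange the next
    one.\<close>
  have key: "(\<integral>\<omega>. (\<Prod>t\<in>A. indicator (B t) (X t \<omega>)) * cos ((\<Sum>t\<in>J. a t * X t \<omega>) + b) \<partial>M)
      = (\<integral>\<omega>. (\<Prod>t\<in>A. indicator (B t) (Y t \<omega>)) * cos ((\<Sum>t\<in>J. a t * Y t \<omega>) + b) \<partial>N)"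
    if "finite A" "A \<subseteq> J" and B: "\<And>t. t \<in> J \<Longrightarrow> B t \<in> sets borel" for A B a b
    using that(1,2)
  proof (induction A arbitrary: a b rule: finite_induct)
    case empty
    then show ?case using eq by simp
  next
    case (insert k A)
    note [measurable] = B
    have bd: "norm (\<Prod>t\<in>A. indicator (B t) (f t) :: real) \<le> 1" for f
      by (simp add: abs_prod) (auto intro!: prod_le_1 simp: indicator_def)
    have m [measurable]: "(\<lambda>\<omega>. \<Prod>t\<in>A. indicator (B t) (X t \<omega>) :: real) \<in> borel_measurable M"
      "(\<lambda>\<omega>. \<Prod>t\<in>A. indicator (B t) (Y t \<omega>) :: real) \<in> borel_measurable N"
      using insert.prems by (auto intro!: borel_measurable_prod borel_measurable_indicator' X Y B)
    have "(\<integral>\<omega>. (\<Prod>t\<in>A. indicator (B t) (X t \<omega>)) * indicator (B k) (X k \<omega>) * cos ((\<Sum>t\<in>J. a t * X t \<omega>) + b) \<partial>M)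
      = (\<integral>\<omega>. (\<Prod>t\<in>A. indicator (B t) (Y t \<omega>)) * indicator (B k) (Y k \<omega>) * cos ((\<Sum>t\<in>J. a t * Y t \<omega>) + b) \<partial>N)"
      using insert B J bd m
      by (intro swap_coordinate X Y M.integrable_const_bound[of _ 1] N.integrable_const_bound[of _ 1])
         (auto intro!: prod_nonneg)
    then show ?case using insert.hyps by (simp add: mult_ac)
  qed
  show ?thesis
  proof (rule measure_eqI_PiM_finite[OF J])
    fix B :: "'i \<Rightarrow> real set" assume B: "\<And>i. i \<in> J \<Longrightarrow> B i \<in> sets borel"
    have m: "(\<lambda>\<omega>. \<lambda>t\<in>J. X t \<omega>) \<in> measurable M (Pi\<^sub>M J (\<lambda>_. borel))"
       "(\<lambda>\<omega>. \<lambda>t\<in>J. Y t \<omega>) \<in> measurable N (Pi\<^sub>M J (\<lambda>_. borel))"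
      by (auto intro!: measurable_restrict)
    have S: "Pi\<^sub>E J B \<in> sets (Pi\<^sub>M J (\<lambda>_. borel))" using B J by (auto intro!: sets_PiM_I_finite)
    have ind: "(\<Prod>t\<in>J. indicator (B t) (f t)) = (indicator (Pi\<^sub>E J B) (\<lambda>t\<in>J. f t) :: real)" for f
      using J by (auto simp: indicator_def PiE_iff prod_zero_iff)
    interpret DM: prob_space "distr M (Pi\<^sub>M J (\<lambda>_. borel)) (\<lambda>\<omega>. \<lambda>t\<in>J. X t \<omega>)"
      by (rule M.prob_space_distr[OF m(1)])
    interpret DN: prob_space "distr N (Pi\<^sub>M J (\<lambda>_. borel)) (\<lambda>\<omega>. \<lambda>t\<in>J. Y t \<omega>)"
      by (rule N.prob_space_distr[OF m(2)])
    have "measure (distr M (Pi\<^sub>M J (\<lambda>_. borel)) (\<lambda>\<omega>. \<lambda>t\<in>J. X t \<omega>)) (Pi\<^sub>E J B)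
        = (\<integral>\<omega>. indicator (Pi\<^sub>E J B) (\<lambda>t\<in>J. X t \<omega>) \<partial>M)"
      using integral_distr[OF m(1), of "indicator (Pi\<^sub>E J B) :: _ \<Rightarrow> real"] S by simp
    \<comment> \<open>With zero coefficients and zero phase the cosine in \<open>key\<close> is
      1.\<close>
    also have "\<dots> = (\<integral>\<omega>. indicator (Pi\<^sub>E J B) (\<lambda>t\<in>J. Y t \<omega>) \<partial>N)"
      using key[OF J subset_refl, of B "\<lambda>_. 0" 0] B by (simp add: ind)
    also have "\<dots> = measure (distr N (Pi\<^sub>M J (\<lambda>_. borel)) (\<lambda>\<omega>. \<lambda>t\<in>J. Y t \<omega>)) (Pi\<^sub>E J B)"
      using integral_distr[OF m(2), of "indicator (Pi\<^sub>E J B) :: _ \<Rightarrow> real"] S by simp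
    finally show "emeasure (distr M (Pi\<^sub>M J (\<lambda>_. borel)) (\<lambda>\<omega>. \<lambda>t\<in>J. X t \<omega>)) (Pi\<^sub>E J B)
        = emeasure (distr N (Pi\<^sub>M J (\<lambda>_. borel)) (\<lambda>\<omega>. \<lambda>t\<in>J. Y t \<omega>)) (Pi\<^sub>E J B)"
      by (simp add: DM.emeasure_eq_measure DN.emeasure_eq_measure)
  next
    interpret DM: prob_space "distr M (Pi\<^sub>M J (\<lambda>_. borel)) (\<lambda>\<omega>. \<lambda>t\<in>J. X t \<omega>)"
      by (rule M.prob_space_distr) (auto intro!: measurable_restrict)
    show "range (\<lambda>_::nat. \<Pi>\<^sub>E i\<in>J. UNIV) \<subseteq> prod_algebra J (\<lambda>_. borel)" by (auto intro!: prod_algebraI_finite J)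
    show "emeasure (distr M (Pi\<^sub>M J (\<lambda>_. borel)) (\<lambda>\<omega>. \<lambda>t\<in>J. X t \<omega>)) (\<Pi>\<^sub>E i\<in>J. UNIV) \<noteq> \<infinity>" for n :: nat
      by simp
  qed (auto simp: space_PiM PiE_def)
qed

section \<open>The covariance function\<close>

lemma tendsto_abs_powr_0:
  fixes p :: real
  assumes "p > 0"
  shows "((\<lambda>y. \<bar>y\<bar> powr p) \<longlongrightarrow> 0) (at (0::real))"
proof -
  have "((\<lambda>y. \<bar>y\<bar> powr p) \<longlongrightarrow> \<bar>0\<bar> powr p) (at (0::real))"
    using assms by (intro tendsto_powr' tendsto_intros) auto
  then show ?thesis by simp
qed

text \<open>At 0 the difference quotient is sgn y * |y|^(p - 1), which tends to 0 because p > 1; so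
  the formula holds across the corner of the absolute value.\<close>

lemma DERIV_abs_powr:
  fixes p x :: real
  assumes "p > 1"
  shows "((\<lambda>x. \<bar>x\<bar> powr p) has_real_derivative p * (sgn x * \<bar>x\<bar> powr (p - 1))) (at x)"
proof -
  consider "x > 0" | "x < 0" | "x = 0" by linarith
  then show ?thesis
  proof cases
    case 1
    have "((\<lambda>x. x powr p) has_real_derivative p * (sgn x * \<bar>x\<bar> powr (p - 1))) (at x)"
      using 1 by (auto intro!: derivative_eq_intros)
    then show ?thesis
      by (rule has_field_derivative_transform_within_open[where S = "{0<..}"]) (use 1 in auto)
  next
    case 2
    have "((\<lambda>x. (- x) powr p) has_real_derivative p * (sgn x * \<bar>x\<bar> powr (p - 1))) (at x)"
      using 2 by (auto intro!: derivative_eq_intros)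
    then show ?thesis
      by (rule has_field_derivative_transform_within_open[where S = "{..<0}"]) (use 2 in auto)
  next
    case 3
    have "((\<lambda>y. sgn y * \<bar>y\<bar> powr (p - 1)) \<longlongrightarrow> 0) (at (0::real))"
      by (rule Lim_null_comparison[OF _ tendsto_abs_powr_0[of "p - 1"]])
         (use assms in \<open>auto simp: abs_mult sgn_if\<close>)
    moreover have "eventually (\<lambda>y. sgn y * \<bar>y\<bar> powr (p - 1) = (\<bar>y\<bar> powr p - \<bar>0\<bar> powr p) / (y - 0)) (at (0::real))"
      by (auto simp: eventually_at_filter powr_diff sgn_if field_simps intro!: always_eventually)
    ultimately have "((\<lambda>y. (\<bar>y\<bar> powr p - \<bar>0\<bar> powr p) / (y - 0)) \<longlongrightarrow> 0) (at (0::real))"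
      by (rule Lim_transform_eventually)
    then show ?thesis
      unfolding has_field_derivative_iff 3 by simp
  qed
qed

text \<open>Up to a factor this is the function that \<open>DERIV_abs_powr\<close> produces, so the
  two together give second derivatives of |x|^q for q > 2.\<close>

lemma DERIV_sgn_abs_powr:
  fixes p x :: real
  assumes "p > 1"
  shows "((\<lambda>x. sgn x * \<bar>x\<bar> powr p) has_real_derivative p * \<bar>x\<bar> powr (p - 1)) (at x)"
proof -
  consider "x > 0" | "x < 0" | "x = 0" by linarith
  then show ?thesis
  proof cases
    case 1
    have "((\<lambda>x. x powr p) has_real_derivative p * \<bar>x\<bar> powr (p - 1)) (at x)"
      using 1 by (auto intro!: derivative_eq_intros)
    then show ?thesis
      by (rule has_field_derivative_transform_within_open[where S = "{0<..}"]) (use 1 in auto)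
  next
    case 2
    have "((\<lambda>x. - ((- x) powr p)) has_real_derivative p * \<bar>x\<bar> powr (p - 1)) (at x)"
      using 2 by (auto intro!: derivative_eq_intros)
    then show ?thesis
      by (rule has_field_derivative_transform_within_open[where S = "{..<0}"]) (use 2 in auto)
  next
    case 3
    have "((\<lambda>y. \<bar>y\<bar> powr (p - 1)) \<longlongrightarrow> 0) (at (0::real))"
      using assms by (intro tendsto_abs_powr_0) auto
    moreover have "eventually (\<lambda>y. \<bar>y\<bar> powr (p - 1) = (sgn y * \<bar>y\<bar> powr p - sgn 0 * \<bar>0\<bar> powr p) / (y - 0)) (at (0::real))"
      by (auto simp: eventually_at_filter powr_diff sgn_if field_simps intro!: always_eventually)
    ultimately have "((\<lambda>y. (sgn y * \<bar>y\<bar> powr p - sgn 0 * \<bar>0\<bar> powr p) / (y - 0)) \<longlongrightarrow> 0) (at (0::real))"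
      by (rule Lim_transform_eventually)
    then show ?thesis
      unfolding has_field_derivative_iff 3 using assms by simp
  qed
qed

lemmas DERIV_abs_powr' [derivative_intros] = DERIV_chain2[OF DERIV_abs_powr]
lemmas DERIV_sgn_abs_powr' [derivative_intros] = DERIV_chain2[OF DERIV_sgn_abs_powr]

text \<open>Used below to compare \<open>pow_sum\<close> with a quadratic in its second argument,
  from either side.\<close>

lemma second_derivative_nonneg:
  fixes f f' f'' :: "real \<Rightarrow> real"
  assumes f: "\<And>x. (f has_real_derivative f' x) (at x)" and f': "\<And>x. (f' has_real_derivative f'' x) (at x)"
    and nn: "\<And>x. 0 \<le> x \<Longrightarrow> x \<le> d \<Longrightarrow> 0 \<le> f'' x" and 0: "f 0 = 0" "f' 0 = 0" and d: "0 \<le> d"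
  shows "0 \<le> f d"
proof -
  have "0 \<le> f' x" if "0 \<le> x" "x \<le> d" for x
    using DERIV_nonneg_imp_nondecreasing[of 0 x f'] f' nn that 0 by force
  then show ?thesis
    using DERIV_nonneg_imp_nondecreasing[of 0 d f] f 0 d by force
qed

text \<open>The mixed partial derivative of the function below is a positive multiple of
  \<open>(a + b) powr (p - 2) - \<bar>a - b\<bar> powr (p - 2)\<close>.\<close>

definition pow_sum :: "real \<Rightarrow> real \<Rightarrow> real \<Rightarrow> real" where
  "pow_sum p a b = \<bar>a + b\<bar> powr p + \<bar>a - b\<bar> powr p"

text \<open>The mixed derivative vanishes on the axes, where the lower corner of the rectangle may
  lie. Positivity on the open intervals, with continuity at their ends, still gives a strict
  inequality.\<close>

lemma pow_sum_supermodular: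
  assumes p: "p > 2" and a: "0 \<le> a1" "a1 < a2" and b: "0 \<le> b1" "b1 < b2"
  shows "pow_sum p a1 b2 + pow_sum p a2 b1 < pow_sum p a1 b1 + pow_sum p a2 b2"
proof -
  \<comment> \<open>\<open>k b a\<close> is the derivative of \<open>pow_sum p a b\<close> in
    \<open>b\<close>, divided by \<open>p\<close>.\<close>
  define k where "k b a = sgn (a + b) * \<bar>a + b\<bar> powr (p - 1) - sgn (a - b) * \<bar>a - b\<bar> powr (p - 1)" for a b :: real
  have k: "k b a1 < k b a2" if "b > 0" for b
  proof (rule DERIV_pos_imp_increasing_open[OF a(2)])
    show "\<exists>y. DERIV (k b) x :> y \<and> y > 0" if "a1 < x" "x < a2" for x
    proof (intro exI conjI)
      show "DERIV (k b) x :> (p - 1) * (\<bar>x + b\<bar> powr (p - 2) - \<bar>x - b\<bar> powr (p - 2))"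
        unfolding k_def using p by (auto intro!: derivative_eq_intros simp: algebra_simps)
      have "\<bar>x - b\<bar> powr (p - 2) < \<bar>x + b\<bar> powr (p - 2)"
        using p that a \<open>b > 0\<close> by (intro powr_less_mono2) auto
      then show "0 < (p - 1) * (\<bar>x + b\<bar> powr (p - 2) - \<bar>x - b\<bar> powr (p - 2))"
        using p by simp
    qed
    have "DERIV (k b) x :> (p - 1) * (\<bar>x + b\<bar> powr (p - 2) - \<bar>x - b\<bar> powr (p - 2))" for x
      unfolding k_def using p by (auto intro!: derivative_eq_intros simp: algebra_simps)
    then have "isCont (k b) x" for x
      by (rule DERIV_isCont)
    then show "continuous_on {a1..a2} (k b)" by (simp add: continuous_at_imp_continuous_on)
  qed
  have D: "DERIV (\<lambda>b. pow_sum p a2 b - pow_sum p a1 b) x :> p * (k x a2 - k x a1)" for x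
    unfolding pow_sum_def k_def using p by (auto intro!: derivative_eq_intros simp: algebra_simps)
  have "pow_sum p a2 b1 - pow_sum p a1 b1 < pow_sum p a2 b2 - pow_sum p a1 b2"
  proof (rule DERIV_pos_imp_increasing_open[OF b(2)])
    show "\<exists>y. DERIV (\<lambda>b. pow_sum p a2 b - pow_sum p a1 b) x :> y \<and> y > 0" if "b1 < x" "x < b2" for x
      using D[of x] k[of x] that b p by (intro exI[of _ "p * (k x a2 - k x a1)"]) auto
    show "continuous_on {b1..b2} (\<lambda>b. pow_sum p a2 b - pow_sum p a1 b)"
      using D by (intro continuous_at_imp_continuous_on ballI) (blast intro: DERIV_isCont)
  qed
  then show ?thesis by simp
qed

text \<open>Up to the factor \<open>h - 2\<close>, this is the variance of the increment over \<open>[s, t]\<close>, in terms of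
  \<open>m = s + t\<close> and \<open>d = t - s\<close>.\<close>

definition incr_var :: "real \<Rightarrow> real \<Rightarrow> real \<Rightarrow> real" where
  "incr_var p m d = pow_sum p m d / 2 - \<bar>m\<bar> powr p - \<bar>d\<bar> powr p"

text \<open>The sum and the difference of s + t and t - s are 2 t and 2 s, so \<open>pow_sum\<close>
  at the rotated point consists of the diagonal powers; the pure powers of s and t cancel. The
  variance is therefore the same function again, at (s + t, t - s).\<close>

lemma incr_var_increment:
  "incr_var p t t - incr_var p t s - incr_var p s t + incr_var p s s = incr_var p (s + t) (t - s)"
proof -
  have "pow_sum p (s + t) (t - s) = \<bar>t + t\<bar> powr p + \<bar>s + s\<bar> powr p" by (simp add: pow_sum_def)
  then show ?thesis
    by (simp add: incr_var_def pow_sum_def abs_minus_commute add.commute field_simps)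
qed

lemma incr_var_mixed:
  "incr_var p v t - incr_var p v s - incr_var p r t + incr_var p r s
    = (pow_sum p v t - pow_sum p v s - pow_sum p r t + pow_sum p r s) / 2"
  by (simp add: incr_var_def field_simps)

lemma incr_var_scale:
  assumes "c > 0"
  shows "incr_var p (c * s) (c * t) = c powr p * incr_var p s t"
proof -
  have "\<bar>c * x\<bar> powr p = c powr p * \<bar>x\<bar> powr p" for x
    using assms by (simp add: abs_mult powr_mult)
  note * = this
  have "pow_sum p (c * s) (c * t) = c powr p * pow_sum p s t"
    unfolding pow_sum_def distrib_left[symmetric] right_diff_distrib[symmetric] * ..
  then show ?thesis
    unfolding incr_var_def * by (simp add: right_diff_distrib)
qed

section \<open>Bounds for the variance of an increment\<close>

lemma incr_var_mono:
  assumes p: "p > 2" and "0 \<le> m1" "m1 \<le> m2" "0 \<le> d"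
  shows "incr_var p m1 d \<le> incr_var p m2 d"
proof (cases "m1 < m2 \<and> 0 < d")
  case True
  then show ?thesis
    using pow_sum_supermodular[OF p, of m1 m2 0 d] assms by (simp add: incr_var_def pow_sum_def field_simps)
next
  case False
  then have "m1 = m2 \<or> d = 0" using assms by auto
  then show ?thesis by (auto simp: incr_var_def pow_sum_def)
qed

text \<open>For an increment starting at s the gap m - d is 2 s, so the diagonal m = d is the worst
  case. There the value is (2 d)^p / 2 - 2 d^p, whence the constant.\<close>

lemma incr_var_lower_diagonal:
  assumes p: "p > 2" and "0 \<le> d" "d \<le> m"
  shows "(2 powr (p - 1) - 2) * d powr p \<le> incr_var p m d"
proof -
  have "incr_var p d d = (2 powr (p - 1) - 2) * d powr p"
    using assms by (simp add: incr_var_def pow_sum_def powr_mult powr_diff algebra_simps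
        flip: mult_2)
  then show ?thesis using incr_var_mono[OF p, of d m d] assms by simp
qed

text \<open>The constant is half of a lower bound for the second derivative in d, obtained by
  keeping only the power of m + x.\<close>

lemma pow_sum_lower:
  assumes p: "p > 2" and d: "0 \<le> d" "d \<le> m"
  shows "p * (p - 1) / 4 * m powr (p - 2) * d\<^sup>2 \<le> pow_sum p m d / 2 - m powr p"
proof -
  define c where "c = p * (p - 1) / 4 * m powr (p - 2)"
  define f where "f x = pow_sum p m x / 2 - m powr p - c * x\<^sup>2" for x
  define f' where "f' x = p / 2 * (sgn (m + x) * \<bar>m + x\<bar> powr (p - 1) - sgn (m - x) * \<bar>m - x\<bar> powr (p - 1)) - 2 * c * x" for x
  define f'' where "f'' x = p * (p - 1) / 2 * (\<bar>m + x\<bar> powr (p - 2) + \<bar>m - x\<bar> powr (p - 2)) - 2 * c" for x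
  have "0 \<le> f d"
  proof (rule second_derivative_nonneg[of f f' f''])
    show "(f has_real_derivative f' x) (at x)" for x
      unfolding f_def f'_def pow_sum_def using p by (auto intro!: derivative_eq_intros simp: field_simps)
    show "(f' has_real_derivative f'' x) (at x)" for x
      unfolding f'_def f''_def using p by (auto intro!: derivative_eq_intros simp: field_simps)
    show "0 \<le> f'' x" if "0 \<le> x" "x \<le> d" for x
    proof -
      have "m powr (p - 2) \<le> \<bar>m + x\<bar> powr (p - 2) + \<bar>m - x\<bar> powr (p - 2)"
        using that d p by (intro order.trans[OF powr_mono2[of "p - 2" m "m + x"]]) auto
      then have "0 \<le> p * (p - 1) / 2 * (\<bar>m + x\<bar> powr (p - 2) + \<bar>m - x\<bar> powr (p - 2) - m powr (p - 2))"
        using p by (intro mult_nonneg_nonneg) auto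
      then show ?thesis
        unfolding f''_def c_def by (simp only: right_diff_distrib)
    qed
  qed (use d in \<open>auto simp: f_def f'_def pow_sum_def\<close>)
  then show ?thesis by (simp add: f_def c_def)
qed

text \<open>For x at most m, both powers in the second derivative are at most (2 m)^(p - 2); the
  constant is generous by a factor of two.\<close>

lemma pow_sum_upper:
  assumes p: "p > 2" and d: "0 \<le> d" "d \<le> m"
  shows "pow_sum p m d / 2 - m powr p \<le> p * (p - 1) * (2 * m) powr (p - 2) * d\<^sup>2"
proof -
  define c where "c = p * (p - 1) * (2 * m) powr (p - 2)"
  define f where "f x = c * x\<^sup>2 - (pow_sum p m x / 2 - m powr p)" for x
  define f' where "f' x = 2 * c * x - p / 2 * (sgn (m + x) * \<bar>m + x\<bar> powr (p - 1) - sgn (m - x) * \<bar>m - x\<bar> powr (p - 1))" for x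
  define f'' where "f'' x = 2 * c - p * (p - 1) / 2 * (\<bar>m + x\<bar> powr (p - 2) + \<bar>m - x\<bar> powr (p - 2))" for x
  have "0 \<le> f d"
  proof (rule second_derivative_nonneg[of f f' f''])
    show "(f has_real_derivative f' x) (at x)" for x
      unfolding f_def f'_def pow_sum_def using p by (auto intro!: derivative_eq_intros simp: field_simps)
    show "(f' has_real_derivative f'' x) (at x)" for x
      unfolding f'_def f''_def using p by (auto intro!: derivative_eq_intros simp: field_simps)
    show "0 \<le> f'' x" if "0 \<le> x" "x \<le> d" for x
    proof -
      have "\<bar>m + x\<bar> powr (p - 2) \<le> (2 * m) powr (p - 2)" "\<bar>m - x\<bar> powr (p - 2) \<le> (2 * m) powr (p - 2)"
        using that d p by (auto intro!: powr_mono2)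
      moreover have "0 \<le> (2 * m) powr (p - 2)" by simp
      ultimately have "\<bar>m + x\<bar> powr (p - 2) + \<bar>m - x\<bar> powr (p - 2) \<le> 4 * (2 * m) powr (p - 2)" by linarith
      then have "0 \<le> p * (p - 1) / 2 * (4 * (2 * m) powr (p - 2) - (\<bar>m + x\<bar> powr (p - 2) + \<bar>m - x\<bar> powr (p - 2)))"
        using p by (intro mult_nonneg_nonneg) auto
      then show ?thesis
        unfolding f''_def c_def by (simp only: right_diff_distrib)
    qed
  qed (use d in \<open>auto simp: f_def f'_def pow_sum_def\<close>)
  then show ?thesis by (simp add: f_def c_def)
qed

lemma incr_var_upper:
  assumes p: "p > 2" and d: "0 \<le> d" "d \<le> m" "m \<le> 2 * T"
  shows "incr_var p m d \<le> p * (p - 1) * (4 * T) powr (p - 2) * d\<^sup>2"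
proof -
  have "(2 * m) powr (p - 2) \<le> (4 * T) powr (p - 2)"
    using assms by (intro powr_mono2) auto
  then have "p * (p - 1) * (2 * m) powr (p - 2) * d\<^sup>2 \<le> p * (p - 1) * (4 * T) powr (p - 2) * d\<^sup>2"
    using p by (intro mult_right_mono mult_left_mono) auto
  moreover have "0 \<le> d powr p" by simp
  moreover have "incr_var p m d = pow_sum p m d / 2 - m powr p - d powr p"
    using d by (simp add: incr_var_def)
  ultimately show ?thesis
    using pow_sum_upper[OF p d(1,2)] by linarith
qed

text \<open>Two regimes: for small d the quadratic gain of \<open>pow_sum\<close> absorbs the loss
  d^p, while for large d the diagonal bound applies, since d^p then dominates d^2.\<close>

lemma incr_var_lower_away_from_0:
  assumes p: "p > 2" and \<epsilon>: "\<epsilon> > 0"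
  obtains C where "C > 0" "\<And>m d. 0 \<le> d \<Longrightarrow> d + \<epsilon> \<le> m \<Longrightarrow> C * d\<^sup>2 \<le> incr_var p m d"
proof -
  \<comment> \<open>\<open>A\<close> is half the coefficient in \<open>pow_sum_lower\<close> at m =
    \<epsilon>, so one half remains after paying for d^p. The threshold \<delta> solves \<delta>^(p
    - 2) = A, which makes d^p at most A d^2 below it and at least A d^2 above it.\<close>
  define A where "A = p * (p - 1) / 8 * \<epsilon> powr (p - 2)"
  define \<delta> where "\<delta> = A powr (1 / (p - 2))"
  define C where "C = min A ((2 powr (p - 1) - 2) * A)"
  have A: "A > 0" using p \<epsilon> by (simp add: A_def)
  have \<delta>: "\<delta> > 0" "\<delta> powr (p - 2) = A" using A p by (simp_all add: \<delta>_def powr_powr)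
  have "2 powr 1 < (2::real) powr (p - 1)" using p by (intro powr_less_mono) auto
  then have two: "2 powr (p - 1) - 2 > (0::real)" by simp
  show thesis
  proof
    show "C > 0" using A two by (simp add: C_def)
    fix m d :: real assume d: "0 \<le> d" "d + \<epsilon> \<le> m"
    have dp: "d powr p = d powr (p - 2) * d\<^sup>2"
      using d by (cases "d = 0") (auto simp: powr_diff)
    show "C * d\<^sup>2 \<le> incr_var p m d"
    proof (cases "d \<le> \<delta>")
      case True
      have "d powr (p - 2) \<le> A" using powr_mono2[of "p - 2" d \<delta>] True d p \<delta> by simp
      moreover have "2 * A \<le> p * (p - 1) / 4 * m powr (p - 2)"
        unfolding A_def using powr_mono2[of "p - 2" \<epsilon> m] d \<epsilon> p
          mult_left_mono[of "\<epsilon> powr (p - 2)" "m powr (p - 2)" "p * (p - 1) / 4"] by simp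
      ultimately have "A \<le> p * (p - 1) / 4 * m powr (p - 2) - d powr (p - 2)" by linarith
      then have "A * d\<^sup>2 \<le> (p * (p - 1) / 4 * m powr (p - 2) - d powr (p - 2)) * d\<^sup>2"
        by (rule mult_right_mono) simp
      also have "\<dots> \<le> incr_var p m d"
        using pow_sum_lower[OF p, of d m] d \<epsilon> dp by (simp add: incr_var_def left_diff_distrib)
      finally have "A * d\<^sup>2 \<le> incr_var p m d" .
      moreover have "C * d\<^sup>2 \<le> A * d\<^sup>2" by (simp add: C_def mult_right_mono)
      ultimately show ?thesis by linarith
    next
      case False
      have "A \<le> d powr (p - 2)" using powr_mono2[of "p - 2" \<delta> d] False p \<delta> by simp
      then have "(2 powr (p - 1) - 2) * A * d\<^sup>2 \<le> (2 powr (p - 1) - 2) * d powr (p - 2) * d\<^sup>2"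
        using two by (intro mult_right_mono mult_left_mono) auto
      also have "\<dots> = (2 powr (p - 1) - 2) * d powr p" by (simp add: dp)
      also have "\<dots> \<le> incr_var p m d"
        using incr_var_lower_diagonal[OF p, of d m] d \<epsilon> by simp
      finally have "(2 powr (p - 1) - 2) * A * d\<^sup>2 \<le> incr_var p m d" .
      moreover have "C * d\<^sup>2 \<le> (2 powr (p - 1) - 2) * A * d\<^sup>2" unfolding C_def by (intro mult_right_mono) auto
      ultimately show ?thesis by linarith
    qed
  qed
qed

section \<open>Expansions at infinity\<close>

lemma powr_expansion3:
  fixes a h :: real
  shows "((\<lambda>T. T powr (3 - h) * (T + a) powr h - (T ^ 3 + h * a * T\<^sup>2 + h * (h - 1) / 2 * a\<^sup>2 * T))
    \<longlongrightarrow> h * (h - 1) * (h - 2) / 6 * a ^ 3) at_top"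
\<comment> \<open>The first factor times the second is T^3 (1 + a / T)^h; the limit is the next
  binomial coefficient after the three subtracted terms.\<close>
proof -
  have "((\<lambda>T. T powr (3 - h) * (T + a) powr h - (T ^ 3 + a * h * T\<^sup>2 + a * (a * ((h - 1) * h)) / 2 * T))
    \<longlongrightarrow> h * (h - 1) * (h - 2) / 6 * a ^ 3) at_top"
    by real_asymp (simp add: power3_eq_cube)
  then show ?thesis by (simp add: power2_eq_square algebra_simps)
qed

lemma powr_expansion2:
  fixes a h :: real
  shows "((\<lambda>T. T powr (2 - h) * (T + a) powr h - (T\<^sup>2 + h * a * T))
    \<longlongrightarrow> h * (h - 1) / 2 * a\<^sup>2) at_top"
  by real_asymp (simp add: power2_eq_square)

lemma eventually_pow_sum:
  "eventually (\<lambda>T. pow_sum h v (t + T) = (T + (t + v)) powr h + (T + (t - v)) powr h) at_top"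
  using eventually_ge_at_top[of "\<bar>t\<bar> + \<bar>v\<bar>"]
proof eventually_elim
  case (elim T)
  then have "\<bar>v + (t + T)\<bar> = T + (t + v)" "\<bar>v - (t + T)\<bar> = T + (t - v)" by auto
  then show ?case by (simp only: pow_sum_def)
qed

lemma pow_sum_expansion3:
  "((\<lambda>T. T powr (3 - h) * pow_sum h v (t + T)
      - (2 * T ^ 3 + 2 * h * t * T\<^sup>2 + h * (h - 1) * (t\<^sup>2 + v\<^sup>2) * T))
    \<longlongrightarrow> h * (h - 1) * (h - 2) / 6 * ((t + v) ^ 3 + (t - v) ^ 3)) at_top"
proof (rule Lim_transform_eventually)
  show "((\<lambda>T. (T powr (3 - h) * (T + (t + v)) powr h
          - (T ^ 3 + h * (t + v) * T\<^sup>2 + h * (h - 1) / 2 * (t + v)\<^sup>2 * T))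
        + (T powr (3 - h) * (T + (t - v)) powr h
          - (T ^ 3 + h * (t - v) * T\<^sup>2 + h * (h - 1) / 2 * (t - v)\<^sup>2 * T)))
    \<longlongrightarrow> h * (h - 1) * (h - 2) / 6 * ((t + v) ^ 3 + (t - v) ^ 3)) at_top"
    unfolding distrib_left[of "h * (h - 1) * (h - 2) / 6"] by (intro tendsto_add powr_expansion3)
  show "eventually (\<lambda>T. (T powr (3 - h) * (T + (t + v)) powr h
          - (T ^ 3 + h * (t + v) * T\<^sup>2 + h * (h - 1) / 2 * (t + v)\<^sup>2 * T))
        + (T powr (3 - h) * (T + (t - v)) powr h
          - (T ^ 3 + h * (t - v) * T\<^sup>2 + h * (h - 1) / 2 * (t - v)\<^sup>2 * T))
      = T powr (3 - h) * pow_sum h v (t + T)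
      - (2 * T ^ 3 + 2 * h * t * T\<^sup>2 + h * (h - 1) * (t\<^sup>2 + v\<^sup>2) * T)) at_top"
    using eventually_pow_sum[of h v t] by eventually_elim (simp add: power2_eq_square field_simps)
qed

text \<open>For fixed T each subtracted term is a function of t plus a function of v, so the mixed
  difference removes it. Of (t + v)^3 + (t - v)^3 = 2 t^3 + 6 t v^2 only the second summand
  survives, which explains the need for third order.\<close>

lemma pow_sum_mixed_difference_limit:
  "((\<lambda>T. T powr (3 - h) * (pow_sum h v (t + T) - pow_sum h v (s + T) - pow_sum h r (t + T) + pow_sum h r (s + T)))
    \<longlongrightarrow> h * (h - 1) * (h - 2) * (t - s) * (v\<^sup>2 - r\<^sup>2)) at_top"
proof -
  let ?L = "\<lambda>v t. h * (h - 1) * (h - 2) / 6 * ((t + v) ^ 3 + (t - v) ^ 3)"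
  let ?f = "\<lambda>v t T. T powr (3 - h) * pow_sum h v (t + T)
      - (2 * T ^ 3 + 2 * h * t * T\<^sup>2 + h * (h - 1) * (t\<^sup>2 + v\<^sup>2) * T)"
  have "((\<lambda>T. ?f v t T - ?f v s T - ?f r t T + ?f r s T) \<longlongrightarrow> ?L v t - ?L v s - ?L r t + ?L r s) at_top"
    by (intro tendsto_add tendsto_diff pow_sum_expansion3)
  moreover have "?L v t - ?L v s - ?L r t + ?L r s = h * (h - 1) * (h - 2) * (t - s) * (v\<^sup>2 - r\<^sup>2)"
    by (simp add: power2_eq_square power3_eq_cube) algebra
  moreover have "(\<lambda>T. ?f v t T - ?f v s T - ?f r t T + ?f r s T) = (\<lambda>T. T powr (3 - h) *
      (pow_sum h v (t + T) - pow_sum h v (s + T) - pow_sum h r (t + T) + pow_sum h r (s + T)))"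
    by (rule ext) (simp add: algebra_simps)
  ultimately show ?thesis by simp
qed

text \<open>Second order suffices for fixed r: the linear terms at r and -r cancel, T^2 is matched
  by the subtracted power of T, and the power of r is damped because h > 2.\<close>

lemma incr_var_limit:
  assumes h: "2 < h"
  shows "((\<lambda>T. T powr (2 - h) * incr_var h r T) \<longlongrightarrow> h * (h - 1) / 2 * r\<^sup>2) at_top"
proof (rule Lim_transform_eventually)
  have "((\<lambda>T. T powr (2 - h)) \<longlongrightarrow> 0) at_top" using h by real_asymp
  then have "((\<lambda>T. ((T powr (2 - h) * (T + r) powr h - (T\<^sup>2 + h * r * T))
        + (T powr (2 - h) * (T + - r) powr h - (T\<^sup>2 + h * (- r) * T))) / 2
        - T powr (2 - h) * \<bar>r\<bar> powr h)
      \<longlongrightarrow> (h * (h - 1) / 2 * r\<^sup>2 + h * (h - 1) / 2 * (- r)\<^sup>2) / 2 - 0 * \<bar>r\<bar> powr h) at_top"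
    by (intro tendsto_intros powr_expansion2) auto
  then show "((\<lambda>T. ((T powr (2 - h) * (T + r) powr h - (T\<^sup>2 + h * r * T))
        + (T powr (2 - h) * (T + - r) powr h - (T\<^sup>2 + h * (- r) * T))) / 2
        - T powr (2 - h) * \<bar>r\<bar> powr h) \<longlongrightarrow> h * (h - 1) / 2 * r\<^sup>2) at_top"
    by (simp add: mult.assoc)
  show "eventually (\<lambda>T. ((T powr (2 - h) * (T + r) powr h - (T\<^sup>2 + h * r * T))
        + (T powr (2 - h) * (T + - r) powr h - (T\<^sup>2 + h * (- r) * T))) / 2
        - T powr (2 - h) * \<bar>r\<bar> powr h = T powr (2 - h) * incr_var h r T) at_top"
    using eventually_pow_sum[of h r 0] eventually_gt_at_top[of 0]
  proof eventually_elim
    case (elim T)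
    then have "T powr (2 - h) * T powr h = T\<^sup>2" by (simp flip: powr_add)
    then show ?case using elim by (simp add: incr_var_def field_simps)
  qed
qed

text \<open>If the identity \<open>R(r, t) R(1, 1) = R(r, 1) R(1, t)\<close> held for \<open>r < 1 < t\<close>, then letting
  \<open>t\<close> tend to infinity would give \<open>R(r, 1) = r\<^sup>2 R(1, 1)\<close>, and differentiating at \<open>r = 1\<close> would give
  \<open>(h - 4) (2 powr (h - 2) - 1) = 0\<close>.\<close>

lemma incr_var_not_multiplicative:
  assumes h: "2 < h" "h < 4"
  shows "\<exists>r t. 0 < r \<and> r < 1 \<and> 1 < t \<and>
    incr_var h r t * incr_var h 1 1 \<noteq> incr_var h r 1 * incr_var h 1 t"
proof (rule ccontr)
  assume "\<not> ?thesis"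
  then have mult: "incr_var h r t * incr_var h 1 1 = incr_var h r 1 * incr_var h 1 t"
    if "0 < r" "r < 1" "1 < t" for r t
    using that by blast
  define f where "f r = incr_var h r 1 - r\<^sup>2 * incr_var h 1 1" for r
  have f0: "f r = 0" if r: "0 < r" "r < 1" for r
  proof -
    have lim: "((\<lambda>T. (T powr (2 - h) * incr_var h r T) * incr_var h 1 1) \<longlongrightarrow> h * (h - 1) / 2 * r\<^sup>2 * incr_var h 1 1) at_top"
      by (intro tendsto_intros incr_var_limit h)
    have lim': "((\<lambda>T. incr_var h r 1 * (T powr (2 - h) * incr_var h 1 T)) \<longlongrightarrow> incr_var h r 1 * (h * (h - 1) / 2 * 1\<^sup>2)) at_top"
      by (intro tendsto_intros incr_var_limit h)
    have ev: "eventually (\<lambda>T. incr_var h r 1 * (T powr (2 - h) * incr_var h 1 T) = (T powr (2 - h) * incr_var h r T) * incr_var h 1 1) at_top"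
      using eventually_gt_at_top[of 1]
    proof eventually_elim
      case (elim T)
      show ?case using mult[OF r elim] by algebra
    qed
    have "h * (h - 1) / 2 * r\<^sup>2 * incr_var h 1 1 = incr_var h r 1 * (h * (h - 1) / 2 * 1\<^sup>2)"
      by (rule tendsto_unique[OF trivial_limit_at_top_linorder lim Lim_transform_eventually[OF lim' ev]])
    then show ?thesis using h by (auto simp: f_def mult_ac)
  qed
  have f1: "f 1 = 0" by (simp add: f_def)
  have i11: "incr_var h 1 1 = 2 powr h / 2 - 2" by (simp add: incr_var_def pow_sum_def)
  define D where "D = (4 - h) * (1 - 2 powr h / 4)"
  have "DERIV f 1 :> h * 2 powr (h - 1) / 2 - h - 2 * (2 powr h / 2 - 2)"
    unfolding f_def i11 incr_var_def pow_sum_def using h by (auto intro!: derivative_eq_intros)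
  moreover have "h * 2 powr (h - 1) / 2 - h - 2 * (2 powr h / 2 - 2) = D"
    by (simp add: D_def powr_diff field_simps)
  ultimately have D: "DERIV f 1 :> D" by simp
  have "2 powr 2 < (2::real) powr h" using h by (intro powr_less_mono) auto
  \<comment> \<open>Both bounds on h enter: 4 - h is positive, and 2^h > 4 makes the other factor
    negative. Hence f is positive just to the left of 1, against \<open>f0\<close>.\<close>
  then have "D < 0" using h unfolding D_def by (intro mult_pos_neg) auto
  then obtain d where d: "d > 0" "\<And>x. x > 0 \<Longrightarrow> x < d \<Longrightarrow> f 1 < f (1 - x)"
    using DERIV_neg_dec_left[OF D] by blast
  define x where "x = min d 1 / 2"
  have "x > 0" "x < d" "x < 1" using d(1) by (auto simp: x_def min_def)
  then show False using d(2)[of x] f1 f0[of "1 - x"] by simp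
qed

section \<open>Gaussian variables and processes\<close>

lemma gaussian_rv_square_integrable:
  assumes "prob_space M" and Y: "gaussian_rv M Y"
  shows "integrable M (\<lambda>\<omega>. (Y \<omega>)\<^sup>2)"
proof -
  interpret prob_space M by fact
  have [measurable]: "Y \<in> borel_measurable M" using Y by (simp add: gaussian_rv_def)
  consider \<mu> where "AE \<omega> in M. Y \<omega> = \<mu>"
    | \<mu> \<sigma> where "0 < \<sigma>" "distributed M lborel Y (normal_density \<mu> \<sigma>)"
    using Y by (auto simp: gaussian_rv_def)
  then show ?thesis
  proof cases
    case 1
    have "integrable M (\<lambda>\<omega>. (Y \<omega>)\<^sup>2) \<longleftrightarrow> integrable M (\<lambda>\<omega>. \<mu>\<^sup>2)"
      using 1 by (intro integrable_cong_AE) auto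
    then show ?thesis by simp
  next
    case 2
    \<comment> \<open>The identity x^2 = (x - \<mu>)^2 + 2 \<mu> x - \<mu>^2 reduces the second
      moment to a central moment.\<close>
    have "integrable lborel (\<lambda>x. normal_density \<mu> \<sigma> x * (x - \<mu>)\<^sup>2 + 2 * \<mu> * (normal_density \<mu> \<sigma> x * x)
        - \<mu>\<^sup>2 * normal_density \<mu> \<sigma> x)"
      using 2(1) by (intro Bochner_Integration.integrable_add Bochner_Integration.integrable_diff
        integrable_mult_right integrable_normal_moment integrable_normal_moment_nz_1 integrable_normal_density)
    then have "integrable lborel (\<lambda>x. normal_density \<mu> \<sigma> x * x\<^sup>2)"
      by (rule back_subst[of "integrable lborel"]) (auto simp: power2_eq_square algebra_simps)
    then show ?thesis
      using distributed_integrable[OF 2(2), of "\<lambda>x. x\<^sup>2"] by simp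
  qed
qed

text \<open>Degenerate variables must be carried along: linear combinations of a Gaussian process
  can vanish, as already the empty sum does.\<close>

lemma gaussian_rv_centered_cases:
  assumes "prob_space M" and Y: "gaussian_rv M Y" and mean: "(\<integral>\<omega>. Y \<omega> \<partial>M) = 0"
  obtains "AE \<omega> in M. Y \<omega> = 0" "(\<integral>\<omega>. (Y \<omega>)\<^sup>2 \<partial>M) = 0"
  | \<sigma> where "0 < \<sigma>" "distributed M lborel Y (normal_density 0 \<sigma>)" "(\<integral>\<omega>. (Y \<omega>)\<^sup>2 \<partial>M) = \<sigma>\<^sup>2"
proof -
  interpret prob_space M by fact
  have [measurable]: "Y \<in> borel_measurable M" using Y by (simp add: gaussian_rv_def)
  consider \<mu> where "AE \<omega> in M. Y \<omega> = \<mu>"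
    | \<mu> \<sigma> where "0 < \<sigma>" "distributed M lborel Y (normal_density \<mu> \<sigma>)"
    using Y by (auto simp: gaussian_rv_def)
  then show thesis
  proof cases
    case 1
    have "(\<integral>\<omega>. Y \<omega> \<partial>M) = (\<integral>\<omega>. \<mu> \<partial>M)" using 1 by (intro integral_cong_AE) auto
    then have "\<mu> = 0" using mean by (simp add: prob_space)
    with 1 have ae: "AE \<omega> in M. Y \<omega> = 0" by simp
    then have "(\<integral>\<omega>. (Y \<omega>)\<^sup>2 \<partial>M) = 0" by (intro integral_eq_zero_AE) auto
    with ae show thesis by (rule that(1))
  next
    case 2
    have "\<mu> = 0" using normal_distributed_expectation[OF 2] mean by simp
    moreover have "(\<integral>\<omega>. (Y \<omega>)\<^sup>2 \<partial>M) = \<sigma>\<^sup>2" using normal_distributed_variance[OF 2] mean by simp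
    ultimately show thesis using 2 that(2) by blast
  qed
qed

text \<open>Since \<sigma> is positive in the normal case, equal variances force both variables into
  the same case and then fix \<sigma>.\<close>

lemma gaussian_rv_centered_law:
  assumes P: "prob_space M" "prob_space N"
    and Y: "gaussian_rv M Y" "(\<integral>\<omega>. Y \<omega> \<partial>M) = 0" and Z: "gaussian_rv N Z" "(\<integral>\<omega>. Z \<omega> \<partial>N) = 0"
    and var: "(\<integral>\<omega>. (Y \<omega>)\<^sup>2 \<partial>M) = (\<integral>\<omega>. (Z \<omega>)\<^sup>2 \<partial>N)"
    and g [measurable]: "g \<in> borel_measurable borel"
  shows "(\<integral>\<omega>. g (Y \<omega>) \<partial>M) = (\<integral>\<omega>. g (Z \<omega>) \<partial>N :: real)"
proof -
  interpret M: prob_space M by fact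
  interpret N: prob_space N by fact
  have [measurable]: "Y \<in> borel_measurable M" "Z \<in> borel_measurable N"
    using Y Z by (simp_all add: gaussian_rv_def)
  show ?thesis
  proof (cases rule: gaussian_rv_centered_cases[OF P(1) Y])
    case 1
    have "AE \<omega> in N. Z \<omega> = 0"
      using var 1 by (cases rule: gaussian_rv_centered_cases[OF P(2) Z]) auto
    then have "(\<integral>\<omega>. g (Z \<omega>) \<partial>N) = (\<integral>\<omega>. g 0 \<partial>N)" by (intro integral_cong_AE) auto
    moreover have "(\<integral>\<omega>. g (Y \<omega>) \<partial>M) = (\<integral>\<omega>. g 0 \<partial>M)" using 1 by (intro integral_cong_AE) auto
    ultimately show ?thesis by (simp add: M.prob_space N.prob_space)
  next
    case (2 \<sigma>)
    have "distributed N lborel Z (normal_density 0 \<sigma>)"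
    proof (cases rule: gaussian_rv_centered_cases[OF P(2) Z])
      case (2 \<tau>)
      then have "\<tau> = \<sigma>" using var \<open>0 < \<sigma>\<close> \<open>_ = \<sigma>\<^sup>2\<close> by (simp add: power2_eq_iff_nonneg)
      with 2 show ?thesis by simp
    qed (use var 2 in auto)
    with 2 show ?thesis
      using distributed_integral[of M lborel Y "normal_density 0 \<sigma>" g] distributed_integral[of N lborel Z "normal_density 0 \<sigma>" g]
      by simp
  qed
qed

section \<open>Centered Gaussian processes with prescribed covariance\<close>

lemma integrable_mult_of_square_integrable:
  fixes f g :: "'a \<Rightarrow> real"
  assumes [measurable]: "f \<in> borel_measurable M" "g \<in> borel_measurable M"
    and "integrable M (\<lambda>x. (f x)\<^sup>2)" "integrable M (\<lambda>x. (g x)\<^sup>2)"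
  shows "integrable M (\<lambda>x. f x * g x)"
proof (rule Bochner_Integration.integrable_bound)
  show "integrable M (\<lambda>x. (f x)\<^sup>2 + (g x)\<^sup>2)" using assms by simp
  have "\<bar>a * b\<bar> \<le> a\<^sup>2 + b\<^sup>2" for a b :: real
  proof -
    have "0 \<le> (\<bar>a\<bar> - \<bar>b\<bar>)\<^sup>2" by simp
    also have "\<dots> = a\<^sup>2 + b\<^sup>2 - 2 * \<bar>a * b\<bar>" by (simp add: power2_diff abs_mult)
    finally show ?thesis using abs_ge_zero[of "a * b"] by linarith
  qed
  then show "AE x in M. norm (f x * g x) \<le> norm ((f x)\<^sup>2 + (g x)\<^sup>2)" by simp
qed simp

locale centered_gaussian = prob_space M for M :: "'a measure" +
  fixes X :: "real \<Rightarrow> 'a \<Rightarrow> real" and K :: "real \<Rightarrow> real \<Rightarrow> real"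
  assumes gaussian: "centered_gaussian_process M X" and covariance: "has_covariance M X K"
begin

lemma gaussian_sum: "finite J \<Longrightarrow> J \<subseteq> {0..} \<Longrightarrow> gaussian_rv M (\<lambda>\<omega>. \<Sum>t\<in>J. a t * X t \<omega>)"
  using gaussian by (simp add: centered_gaussian_process_def)

lemma gaussian_X: "t \<ge> 0 \<Longrightarrow> gaussian_rv M (X t)"
  using gaussian_sum[of "{t}" "\<lambda>_. 1"] by simp

lemma measurable_X: "t \<ge> 0 \<Longrightarrow> X t \<in> borel_measurable M"
  using gaussian_X by (simp add: gaussian_rv_def)

lemma square_integrable_X: "t \<ge> 0 \<Longrightarrow> integrable M (\<lambda>\<omega>. (X t \<omega>)\<^sup>2)"
  by (intro gaussian_rv_square_integrable gaussian_X prob_space_axioms)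

lemma integrable_X: "t \<ge> 0 \<Longrightarrow> integrable M (X t)"
  by (rule square_integrable_imp_integrable[OF measurable_X square_integrable_X])

lemma integrable_XX: "s \<ge> 0 \<Longrightarrow> t \<ge> 0 \<Longrightarrow> integrable M (\<lambda>\<omega>. X s \<omega> * X t \<omega>)"
  by (intro integrable_mult_of_square_integrable measurable_X square_integrable_X)

lemma mean_X: "t \<ge> 0 \<Longrightarrow> (\<integral>\<omega>. X t \<omega> \<partial>M) = 0"
  using gaussian by (simp add: centered_gaussian_process_def)

lemma cov_X: "s \<ge> 0 \<Longrightarrow> t \<ge> 0 \<Longrightarrow> (\<integral>\<omega>. X s \<omega> * X t \<omega> \<partial>M) = K s t"
  using covariance by (simp add: has_covariance_def)

lemma cov_increments:
  assumes "r \<ge> 0" "v \<ge> 0" "s \<ge> 0" "t \<ge> 0"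
  shows "(\<integral>\<omega>. (X v \<omega> - X r \<omega>) * (X t \<omega> - X s \<omega>) \<partial>M) = K v t - K v s - K r t + K r s"
proof -
  have "(\<integral>\<omega>. (X v \<omega> - X r \<omega>) * (X t \<omega> - X s \<omega>) \<partial>M)
    = (\<integral>\<omega>. X v \<omega> * X t \<omega> - X v \<omega> * X s \<omega> - X r \<omega> * X t \<omega> + X r \<omega> * X s \<omega> \<partial>M)"
    by (simp add: algebra_simps)
  then show ?thesis using assms by (simp add: integrable_XX cov_X)
qed

lemma mean_sum: "finite J \<Longrightarrow> J \<subseteq> {0..} \<Longrightarrow> (\<integral>\<omega>. (\<Sum>t\<in>J. a t * X t \<omega>) \<partial>M) = 0"
  by (subst Bochner_Integration.integral_sum) (auto simp: integrable_X mean_X subset_iff)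

lemma variance_sum:
  assumes "finite J" "J \<subseteq> {0..}"
  shows "(\<integral>\<omega>. (\<Sum>t\<in>J. a t * X t \<omega>)\<^sup>2 \<partial>M) = (\<Sum>s\<in>J. \<Sum>t\<in>J. a s * a t * K s t)"
proof -
  have "(\<integral>\<omega>. (\<Sum>t\<in>J. a t * X t \<omega>)\<^sup>2 \<partial>M)
      = (\<integral>\<omega>. (\<Sum>s\<in>J. \<Sum>t\<in>J. a s * a t * (X s \<omega> * X t \<omega>)) \<partial>M)"
    by (simp add: power2_eq_square sum_product mult_ac)
  also have "\<dots> = (\<Sum>s\<in>J. \<Sum>t\<in>J. a s * a t * K s t)"
    using assms by (simp add: Bochner_Integration.integral_sum integrable_XX cov_X subset_iff)
  finally show ?thesis .
qed

text \<open>Corresponding linear combinations are centered Gaussian with the same variance, hence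
  equal in law, and \<open>Cramer_Wold\<close> assembles them.\<close>

lemma fdd_eq_cong:
  assumes "centered_gaussian N Y K"
  shows "fdd_eq M X N Y"
  unfolding fdd_eq_def
proof (intro allI impI)
  interpret Y: centered_gaussian N Y K by fact
  fix J :: "real set" assume J: "finite J \<and> J \<subseteq> {0..}"
  then have J': "finite J" "J \<subseteq> {0..}" by auto
  show "distr M (Pi\<^sub>M J (\<lambda>_. borel)) (\<lambda>\<omega>. \<lambda>t\<in>J. X t \<omega>) = distr N (Pi\<^sub>M J (\<lambda>_. borel)) (\<lambda>\<omega>. \<lambda>t\<in>J. Y t \<omega>)"
  proof (rule Cramer_Wold)
    show "(\<integral>\<omega>. cos ((\<Sum>t\<in>J. a t * X t \<omega>) + b) \<partial>M) = (\<integral>\<omega>. cos ((\<Sum>t\<in>J. a t * Y t \<omega>) + b) \<partial>N)" for a b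
      by (rule gaussian_rv_centered_law[where g = "\<lambda>x. cos (x + b)"])
         (use J' in \<open>auto simp: gaussian_sum Y.gaussian_sum mean_sum Y.mean_sum variance_sum Y.variance_sum
            prob_space_axioms Y.prob_space_axioms\<close>)
  qed (use J' in \<open>auto intro: measurable_X Y.measurable_X prob_space_axioms Y.prob_space_axioms\<close>)
qed

lemma time_scaled:
  assumes c: "c > 0"
  shows "centered_gaussian M (\<lambda>t. X (c * t)) (\<lambda>s t. K (c * s) (c * t))"
proof
  have "gaussian_rv M (\<lambda>\<omega>. \<Sum>t\<in>J. a t * X (c * t) \<omega>)" if "finite J" "J \<subseteq> {0..}" for J a
  proof -
    have "(\<Sum>t\<in>J. a t * X (c * t) \<omega>) = (\<Sum>u\<in>(\<lambda>t. c * t) ` J. a (u / c) * X u \<omega>)" for \<omega>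
      using c by (subst sum.reindex) (auto simp: inj_on_def)
    moreover have "(\<lambda>t. c * t) ` J \<subseteq> {0..}" using that c by auto
    ultimately show ?thesis
      using gaussian_sum[of "(\<lambda>t. c * t) ` J" "\<lambda>u. a (u / c)"] that by simp
  qed
  then show "centered_gaussian_process M (\<lambda>t. X (c * t))"
    using c by (auto simp: centered_gaussian_process_def mean_X)
  show "has_covariance M (\<lambda>t. X (c * t)) (\<lambda>s t. K (c * s) (c * t))"
    using c by (auto simp: has_covariance_def cov_X)
qed

lemma space_scaled: "centered_gaussian M (\<lambda>t \<omega>. c * X t \<omega>) (\<lambda>s t. c\<^sup>2 * K s t)"
proof
  show "centered_gaussian_process M (\<lambda>t \<omega>. c * X t \<omega>)"
    using gaussian_sum[where a = "\<lambda>t. c * a t" for a]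
    by (auto simp: centered_gaussian_process_def mean_X integrable_X mult_ac)
  have "(\<integral>\<omega>. c * X s \<omega> * (c * X t \<omega>) \<partial>M) = c\<^sup>2 * K s t" if "s \<ge> 0" "t \<ge> 0" for s t
  proof -
    have "(\<integral>\<omega>. c * X s \<omega> * (c * X t \<omega>) \<partial>M) = (\<integral>\<omega>. c\<^sup>2 * (X s \<omega> * X t \<omega>) \<partial>M)"
      by (simp add: power2_eq_square mult_ac)
    then show ?thesis using that by (simp add: cov_X)
  qed
  then show "has_covariance M (\<lambda>t \<omega>. c * X t \<omega>) (\<lambda>s t. c\<^sup>2 * K s t)"
    by (auto simp: has_covariance_def)
qed

end

text \<open>The vectors \<open>(V, X)\<close> and \<open>(- V, X)\<close> have the same law.\<close>

lemma gaussian_uncorrelated_orthogonal: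
  fixes V X :: "'a \<Rightarrow> real"
  assumes P: "prob_space M" and gauss: "\<And>\<alpha> \<beta>. gaussian_rv M (\<lambda>\<omega>. \<alpha> * V \<omega> + \<beta> * X \<omega>)"
    and mean: "(\<integral>\<omega>. V \<omega> \<partial>M) = 0" "(\<integral>\<omega>. X \<omega> \<partial>M) = 0" and cov: "(\<integral>\<omega>. V \<omega> * X \<omega> \<partial>M) = 0"
    and B [measurable]: "B \<in> sets borel"
  shows "(\<integral>\<omega>. V \<omega> * indicator B (X \<omega>) \<partial>M) = 0"
proof -
  interpret prob_space M by fact
  have V: "gaussian_rv M V" and X: "gaussian_rv M X" using gauss[of 1 0] gauss[of 0 1] by simp_all
  have [measurable]: "V \<in> borel_measurable M" "X \<in> borel_measurable M"
    using V X by (simp_all add: gaussian_rv_def)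
  note sq = gaussian_rv_square_integrable[OF P V] gaussian_rv_square_integrable[OF P X]
  have int: "integrable M V" "integrable M X" "integrable M (\<lambda>\<omega>. V \<omega> * X \<omega>)"
    by (rule square_integrable_imp_integrable[OF _ sq(1)] square_integrable_imp_integrable[OF _ sq(2)]
      integrable_mult_of_square_integrable[OF _ _ sq]; measurable)+
  \<comment> \<open>Zero correlation removes the cross term, so the variance does not see the sign
    of \<alpha>.\<close>
  have var: "(\<integral>\<omega>. (\<alpha> * V \<omega> + \<beta> * X \<omega>)\<^sup>2 \<partial>M) = \<alpha>\<^sup>2 * (\<integral>\<omega>. (V \<omega>)\<^sup>2 \<partial>M) + \<beta>\<^sup>2 * (\<integral>\<omega>. (X \<omega>)\<^sup>2 \<partial>M)" for \<alpha> \<beta>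
  proof -
    have "(\<integral>\<omega>. (\<alpha> * V \<omega> + \<beta> * X \<omega>)\<^sup>2 \<partial>M)
      = (\<integral>\<omega>. \<alpha>\<^sup>2 * (V \<omega>)\<^sup>2 + \<beta>\<^sup>2 * (X \<omega>)\<^sup>2 + 2 * \<alpha> * \<beta> * (V \<omega> * X \<omega>) \<partial>M)"
      by (simp add: power2_eq_square algebra_simps)
    then show ?thesis using sq int by (simp add: cov)
  qed
  have mean0: "(\<integral>\<omega>. \<alpha> * V \<omega> + \<beta> * X \<omega> \<partial>M) = 0" for \<alpha> \<beta>
    using int mean by simp
  \<comment> \<open>The pair is encoded as a family over the booleans: \<open>True\<close> is the
    signed V, \<open>False\<close> is X.\<close>
  define Y where "Y \<epsilon> b = (if b then \<lambda>\<omega>. \<epsilon> * V \<omega> else X)" for \<epsilon> b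
  have [measurable]: "Y \<epsilon> b \<in> borel_measurable M" for \<epsilon> b by (cases b) (simp_all add: Y_def)
  have S: "(\<Sum>b\<in>UNIV. a b * Y \<epsilon> b \<omega>) = (\<epsilon> * a True) * V \<omega> + a False * X \<omega>" for a \<epsilon> \<omega>
    by (simp add: UNIV_bool Y_def)
  let ?D = "\<lambda>\<epsilon>. distr M (Pi\<^sub>M UNIV (\<lambda>_. borel)) (\<lambda>\<omega>. \<lambda>b\<in>UNIV. Y \<epsilon> b \<omega>)"
  have "?D 1 = ?D (- 1)"
  proof (rule Cramer_Wold[OF P P])
    show "(\<integral>\<omega>. cos ((\<Sum>b\<in>UNIV. a b * Y 1 b \<omega>) + c) \<partial>M) = (\<integral>\<omega>. cos ((\<Sum>b\<in>UNIV. a b * Y (- 1) b \<omega>) + c) \<partial>M)" for a c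
      unfolding S
    proof (rule gaussian_rv_centered_law[OF P P gauss mean0 gauss mean0, where g = "\<lambda>x. cos (x + c)"])
      show "(\<integral>\<omega>. (1 * a True * V \<omega> + a False * X \<omega>)\<^sup>2 \<partial>M)
          = (\<integral>\<omega>. (- 1 * a True * V \<omega> + a False * X \<omega>)\<^sup>2 \<partial>M)"
        unfolding var by (simp only: mult_minus1 mult_1 power2_minus)
    qed measurable
  qed auto
  note D = this
  have E: "(\<integral>x. x True * indicator B (x False) \<partial>?D \<epsilon>) = \<epsilon> * (\<integral>\<omega>. V \<omega> * indicator B (X \<omega>) \<partial>M)" for \<epsilon>
  proof -
    have "(\<integral>x. x True * indicator B (x False) \<partial>?D \<epsilon>)
        = (\<integral>\<omega>. (\<lambda>b\<in>UNIV. Y \<epsilon> b \<omega>) True * indicator B ((\<lambda>b\<in>UNIV. Y \<epsilon> b \<omega>) False) \<partial>M)"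
      by (rule integral_distr) measurable
    also have "\<dots> = (\<integral>\<omega>. \<epsilon> * (V \<omega> * indicator B (X \<omega>)) \<partial>M)"
      by (simp add: Y_def mult.assoc)
    finally show ?thesis by simp
  qed
  \<comment> \<open>Equality of the two joint laws makes the integral equal to its own
    negative.\<close>
  have "1 * (\<integral>\<omega>. V \<omega> * indicator B (X \<omega>) \<partial>M) = (\<integral>x. x True * indicator B (x False) \<partial>?D 1)"
    by (rule E[symmetric])
  also have "\<dots> = (\<integral>x. x True * indicator B (x False) \<partial>?D (- 1))"
    by (rule arg_cong[OF D, of "\<lambda>D. \<integral>x. x True * indicator B (x False) \<partial>D"])
  also have "\<dots> = - 1 * (\<integral>\<omega>. V \<omega> * indicator B (X \<omega>) \<partial>M)"
    by (rule E)
  finally show ?thesis by simp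
qed

section \<open>The Markov property of Gaussian processes\<close>

lemma subalgebra_vimage_algebra:
  assumes "X \<in> borel_measurable M"
  shows "subalgebra M (vimage_algebra (space M) X borel)"
  using assms by (auto simp: subalgebra_def sets_vimage_algebra2 intro: measurable_sets)

text \<open>Orthogonality to the events of X says that V has conditional expectation zero given X,
  and g can be pulled out of it. It is used below for a conditional probability given X s and for g
  = X t.\<close>

lemma integral_mult_vimage_measurable_eq_0:
  fixes V X g :: "'a \<Rightarrow> real"
  assumes P: "prob_space M" and X [measurable]: "X \<in> borel_measurable M" and V: "integrable M V"
    and orth: "\<And>B. B \<in> sets borel \<Longrightarrow> (\<integral>\<omega>. V \<omega> * indicator B (X \<omega>) \<partial>M) = 0"
    and g: "g \<in> borel_measurable (vimage_algebra (space M) X borel)" and gV: "integrable M (\<lambda>\<omega>. g \<omega> * V \<omega>)"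
  shows "(\<integral>\<omega>. g \<omega> * V \<omega> \<partial>M) = 0"
proof -
  interpret prob_space M by fact
  let ?F = "vimage_algebra (space M) X borel"
  interpret finite_measure_subalgebra M ?F
    by unfold_locales (rule subalgebra_vimage_algebra[OF X])
  have "AE \<omega> in M. real_cond_exp M ?F V \<omega> = 0"
  proof (rule real_cond_exp_charact)
    fix A assume "A \<in> sets ?F"
    then obtain B where B: "B \<in> sets borel" "A = X -` B \<inter> space M"
      by (auto simp: sets_vimage_algebra2)
    have "(\<integral>\<omega>\<in>A. V \<omega> \<partial>M) = (\<integral>\<omega>. V \<omega> * indicator B (X \<omega>) \<partial>M)"
      unfolding set_lebesgue_integral_def B(2)
      by (rule Bochner_Integration.integral_cong) (auto simp: indicator_def)
    then show "(\<integral>\<omega>\<in>A. V \<omega> \<partial>M) = (\<integral>\<omega>\<in>A. 0 \<partial>M)" using orth[OF B(1)] by simp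
  qed (use V in auto)
  then have "(\<integral>\<omega>. g \<omega> * real_cond_exp M ?F V \<omega> \<partial>M) = 0"
    by (intro integral_eq_zero_AE) auto
  then show ?thesis
    using real_cond_exp_intg(2)[OF gV g] V by simp
qed

section \<open>The natural filtration\<close>

lemma space_natural_filtration [simp]: "space (natural_filtration M X t) = space M"
  unfolding natural_filtration_def by (rule space_measure_of) auto

lemma sets_natural_filtration:
  "sets (natural_filtration M X t) =
     sigma_sets (space M) (\<Union>s\<in>{0..t}. {X s -` B \<inter> space M | B. B \<in> sets borel})"
  unfolding natural_filtration_def by (rule sets_measure_of) auto

lemma measurable_natural_filtration:
  assumes "0 \<le> s" "s \<le> t"
  shows "X s \<in> borel_measurable (natural_filtration M X t)"
proof (rule measurableI)
  fix B :: "real set" assume "B \<in> sets borel"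
  then show "X s -` B \<inter> space (natural_filtration M X t) \<in> sets (natural_filtration M X t)"
    using assms by (auto simp: sets_natural_filtration intro!: sigma_sets.Basic bexI[of _ s] exI[of _ B])
qed simp

lemma adapted_natural_filtration: "adapted (natural_filtration M X) X"
  by (simp add: adapted_def measurable_natural_filtration)

lemma filtration_on_natural_filtration:
  assumes X: "\<And>t. t \<ge> 0 \<Longrightarrow> X t \<in> borel_measurable M"
  shows "filtration_on M (natural_filtration M X)"
  unfolding filtration_on_def
proof (intro conjI allI)
  show "filtration (space M) (natural_filtration M X)"
  proof
    show "sets (natural_filtration M X i) \<subseteq> sets (natural_filtration M X j)" if "i \<le> j" for i j
      unfolding sets_natural_filtration using that by (intro sigma_sets_mono') fastforce
  qed simp
  show "subalgebra M (natural_filtration M X t)" for t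
    unfolding subalgebra_def sets_natural_filtration
    by (auto intro!: sets.sigma_sets_subset measurable_sets[OF X])
qed

text \<open>The variable \<open>V = K s s * X r - K r s * X s\<close> is known at time \<open>s\<close> and uncorrelated with
  \<open>X s\<close>; by the Markov property it is orthogonal to \<open>X t\<close>.\<close>

lemma (in centered_gaussian) markov_covariance:
  assumes markov: "markov_process M (natural_filtration M X) X" and t: "0 \<le> r" "r \<le> s" "s \<le> t"
  shows "K r t * K s s = K r s * K s t"
proof -
  let ?F = "natural_filtration M X s" and ?G = "\<lambda>s. vimage_algebra (space M) (X s) borel"
  have [measurable]: "X r \<in> borel_measurable M" "X s \<in> borel_measurable M" "X t \<in> borel_measurable M"
    using t by (auto intro: measurable_X)
  interpret F: finite_measure_subalgebra M ?F
    using markov by unfold_locales (auto simp: markov_process_def filtration_on_def)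
  interpret G: finite_measure_subalgebra M "?G s"
    by unfold_locales (simp add: subalgebra_vimage_algebra)
  define V where "V \<omega> = K s s * X r \<omega> - K r s * X s \<omega>" for \<omega>
  have V_F: "V \<in> borel_measurable ?F"
    unfolding V_def[abs_def] using t by (auto intro!: borel_measurable_diff borel_measurable_times measurable_natural_filtration)
  have [measurable]: "V \<in> borel_measurable M" by (simp add: V_def[abs_def])
  have V_int: "integrable M V" using t by (auto simp: V_def[abs_def] integrable_X)
  have orth: "(\<integral>\<omega>. V \<omega> * indicator B (X s \<omega>) \<partial>M) = 0" if "B \<in> sets borel" for B
  proof (rule gaussian_uncorrelated_orthogonal[OF prob_space_axioms _ _ _ _ that])
    show "gaussian_rv M (\<lambda>\<omega>. \<alpha> * V \<omega> + \<beta> * X s \<omega>)" for \<alpha> \<beta>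
    \<comment> \<open>For r = s the index set {r, s} collapses to one point, but then V is
      zero.\<close>
    proof (cases "r = s")
      case True
      then show ?thesis
        using gaussian_sum[of "{s}" "\<lambda>_. \<beta>"] t by (simp add: V_def)
    next
      case False
      then have "(\<Sum>u\<in>{r, s}. (if u = r then \<alpha> * K s s else \<beta> - \<alpha> * K r s) * X u \<omega>) = \<alpha> * V \<omega> + \<beta> * X s \<omega>" for \<omega>
        by (simp add: V_def algebra_simps)
      then show ?thesis
        using gaussian_sum[of "{r, s}" "\<lambda>u. if u = r then \<alpha> * K s s else \<beta> - \<alpha> * K r s"] t by simp
    qed
    show "(\<integral>\<omega>. V \<omega> \<partial>M) = 0" using t by (simp add: V_def integrable_X mean_X)
    show "(\<integral>\<omega>. X s \<omega> \<partial>M) = 0" using t by (simp add: mean_X)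
    have "(\<integral>\<omega>. V \<omega> * X s \<omega> \<partial>M) = (\<integral>\<omega>. K s s * (X r \<omega> * X s \<omega>) - K r s * (X s \<omega> * X s \<omega>) \<partial>M)"
      by (simp add: V_def algebra_simps)
    then show "(\<integral>\<omega>. V \<omega> * X s \<omega> \<partial>M) = 0" using t by (simp add: integrable_XX cov_X)
  qed
  \<comment> \<open>As V is known at time s, the indicator may be replaced by its conditional
    expectation; the Markov property makes that a function of X s, to which V is orthogonal.\<close>
  have orth_t: "(\<integral>\<omega>. V \<omega> * indicator B (X t \<omega>) \<partial>M) = 0" if B [measurable]: "B \<in> sets borel" for B
  proof -
    define I where "I = (indicator (X t -` B \<inter> space M) :: 'a \<Rightarrow> real)"
    define g where "g = real_cond_exp M (?G s) I"
    have [measurable]: "I \<in> borel_measurable M" by (simp add: I_def)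
    have I: "integrable M I"
      unfolding I_def by (intro integrable_real_indicator) (auto simp: less_top[symmetric])
    have VI: "integrable M (\<lambda>\<omega>. V \<omega> * I \<omega>)"
      by (rule Bochner_Integration.integrable_bound[OF V_int]) (auto simp: I_def indicator_def)
    have gF: "AE \<omega> in M. real_cond_exp M ?F I \<omega> = g \<omega>"
      using markov t B by (simp add: markov_process_def g_def I_def)
    have g_G: "g \<in> borel_measurable (?G s)" by (simp add: g_def)
    have [measurable]: "g \<in> borel_measurable M" by (simp add: g_def)
    have "AE \<omega> in M. 0 \<le> g \<omega>" "AE \<omega> in M. g \<omega> \<le> 1"
      unfolding g_def using I by (auto intro!: G.real_cond_exp_ge_c G.real_cond_exp_le_c simp: I_def indicator_def)
    then have gV: "integrable M (\<lambda>\<omega>. g \<omega> * V \<omega>)"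
      by (intro Bochner_Integration.integrable_bound[OF V_int])
         (auto simp: abs_mult intro!: mult_left_le_one_le)
    have "(\<integral>\<omega>. V \<omega> * indicator B (X t \<omega>) \<partial>M) = (\<integral>\<omega>. V \<omega> * I \<omega> \<partial>M)"
      by (rule Bochner_Integration.integral_cong) (auto simp: I_def indicator_def)
    also have "\<dots> = (\<integral>\<omega>. V \<omega> * real_cond_exp M ?F I \<omega> \<partial>M)"
      using F.real_cond_exp_intg(2)[OF VI V_F] by simp
    also have "\<dots> = (\<integral>\<omega>. g \<omega> * V \<omega> \<partial>M)"
      by (rule integral_cong_AE) (use gF in auto)
    also have "\<dots> = 0"
      by (rule integral_mult_vimage_measurable_eq_0[OF prob_space_axioms _ V_int orth g_G gV]) auto
    finally show ?thesis .
  qed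
  \<comment> \<open>Passing from indicators of X t to X t itself: the integral of this product is
    the difference of the two sides of the claim.\<close>
  have XV: "(\<lambda>\<omega>. X t \<omega> * V \<omega>) = (\<lambda>\<omega>. K s s * (X r \<omega> * X t \<omega>) - K r s * (X s \<omega> * X t \<omega>))"
    by (auto simp: V_def algebra_simps)
  have "integrable M (\<lambda>\<omega>. X t \<omega> * V \<omega>)" unfolding XV using t by (simp add: integrable_XX)
  moreover have "X t \<in> borel_measurable (?G t)" by (rule measurable_vimage_algebra1) simp
  ultimately have "(\<integral>\<omega>. X t \<omega> * V \<omega> \<partial>M) = 0"
    by (intro integral_mult_vimage_measurable_eq_0[OF prob_space_axioms _ V_int orth_t]) auto
  then show ?thesis unfolding XV using t by (simp add: integrable_XX cov_X mult.commute)
qed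

section \<open>Continuously differentiable paths\<close>

lemma continuously_differentiable_path_integral:
  assumes g: "continuous_on {0..} g" and f: "\<And>t. t \<ge> 0 \<Longrightarrow> f t = c * integral {0..t} g"
  shows "continuously_differentiable_path f"
  unfolding continuously_differentiable_path_def
proof (intro exI conjI allI impI)
  show "continuous_on {0..} (\<lambda>t. c * g t)" using g by (intro continuous_intros)
  fix t :: real assume t: "t \<ge> 0"
  \<comment> \<open>The endpoint t + 1 keeps t away from the right end, so near t the interval looks
    like the half-line.\<close>
  have "((\<lambda>x. integral {0..x} g) has_real_derivative g t) (at t within {0..t + 1})"
    using t by (intro integral_has_real_derivative continuous_on_subset[OF g]) auto
  moreover have "at t within {0..t + 1} = at t within {0..}"
    by (rule at_within_nhd[of t "{..<t + 1}"]) auto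
  ultimately have "((\<lambda>x. c * integral {0..x} g) has_real_derivative c * g t) (at t within {0..})"
    by (intro DERIV_cmult) simp
  then show "(f has_real_derivative c * g t) (at t within {0..})"
    by (rule has_field_derivative_transform_within[OF _ zero_less_one]) (use t f in auto)
qed

lemma continuously_differentiable_path_cadlag:
  assumes "continuously_differentiable_path f"
  shows "cadlag f"
proof -
  have c: "(f \<longlongrightarrow> f t) (at t within {0..})" if "t \<ge> 0" for t
    using assms that DERIV_continuous unfolding continuously_differentiable_path_def continuous_within by blast
  show ?thesis
    unfolding cadlag_def
  proof (intro conjI allI impI)
    fix t :: real assume t: "t \<ge> 0"
    show "(f \<longlongrightarrow> f t) (at_right t)"
      by (rule tendsto_within_subset[OF c[OF t]]) (use t in auto)
  next
    fix t :: real assume t: "t > 0"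
    have "at t within {0..} = at t" by (rule at_within_interior) (use t in simp)
    then have "(f \<longlongrightarrow> f t) (at t)" using c[of t] t by simp
    then show "\<exists>l. (f \<longlongrightarrow> l) (at_left t)" using filterlim_at_split by blast
  qed
qed

text \<open>On the compact interval [0, T] the derivative is bounded by some L, so every partition
  sum is at most L T.\<close>

lemma continuously_differentiable_path_finite_variation:
  assumes "continuously_differentiable_path f"
  shows "locally_finite_variation f"
  unfolding locally_finite_variation_def
proof (intro allI impI)
  fix T :: real assume T: "T \<ge> 0"
  obtain f' where f': "continuous_on {0..} f'" "\<And>t. t \<ge> 0 \<Longrightarrow> (f has_real_derivative f' t) (at t within {0..})"
    using assms unfolding continuously_differentiable_path_def by blast
  have "bounded (f' ` {0..T})"
    by (intro compact_imp_bounded compact_continuous_image continuous_on_subset[OF f'(1)]) auto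
  then obtain L where "\<forall>y\<in>f' ` {0..T}. norm y \<le> L"
    unfolding bounded_iff by blast
  then have L: "norm (f' t) \<le> L" if "t \<in> {0..T}" for t
    using that by blast
  have "0 \<le> L" using L[of 0] T norm_ge_zero[of "f' 0"] by (simp del: norm_ge_zero)
  have lip: "\<bar>f y - f x\<bar> \<le> L * \<bar>y - x\<bar>" if "x \<in> {0..T}" "y \<in> {0..T}" for x y
  proof -
    have "(f has_real_derivative f' u) (at u within {0..T})" if "u \<in> {0..T}" for u
      by (rule DERIV_subset[OF f'(2)]) (use that in auto)
    then have "norm (f y - f x) \<le> L * norm (y - x)"
      by (rule field_differentiable_bound[OF convex_closed_interval _ L that(2,1)])
    then show ?thesis by simp
  qed
  show "\<exists>B. \<forall>(n::nat) p. mono p \<and> range p \<subseteq> {0..T} \<longrightarrow> (\<Sum>i<n. \<bar>f (p (Suc i)) - f (p i)\<bar>) \<le> B"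
  proof (intro exI allI impI)
    fix n :: nat and p :: "nat \<Rightarrow> real" assume p: "mono p \<and> range p \<subseteq> {0..T}"
    then have pT: "p i \<in> {0..T}" for i by blast
    have "(\<Sum>i<n. \<bar>f (p (Suc i)) - f (p i)\<bar>) \<le> (\<Sum>i<n. L * (p (Suc i) - p i))"
    proof (rule sum_mono)
      fix i
      have "p i \<le> p (Suc i)" using p by (auto simp: mono_iff_le_Suc)
      then show "\<bar>f (p (Suc i)) - f (p i)\<bar> \<le> L * (p (Suc i) - p i)"
        using lip[OF pT[of i] pT[of "Suc i"]] by simp
    qed
    also have "\<dots> = L * (p n - p 0)"
      by (simp add: sum_distrib_left[symmetric] sum_lessThan_telescope)
    also have "\<dots> \<le> L * T"
      using \<open>0 \<le> L\<close> pT[of n] pT[of 0] by (intro mult_left_mono) auto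
    finally show "(\<Sum>i<n. \<bar>f (p (Suc i)) - f (p i)\<bar>) \<le> L * T" .
  qed
qed

lemma local_martingale_zero:
  assumes P: "prob_space M" and F: "filtration_on M F"
  shows "local_martingale M F (\<lambda>_ _. 0)"
  unfolding local_martingale_def
proof (intro conjI exI[of _ "\<lambda>n _. of_nat n"] allI)
  interpret prob_space M by fact
  show "martingale M F (\<lambda>t \<omega>. stopped (\<lambda>_ _. 0) (\<lambda>_. of_nat n) t \<omega> - 0)" for n
    unfolding martingale_def stopped_def
  proof (intro conjI allI impI)
    fix s t :: real
    interpret finite_measure_subalgebra M "F s"
      using F by unfold_locales (simp add: filtration_on_def)
    show "AE \<omega> in M. real_cond_exp M (F s) (\<lambda>\<omega>. 0 - 0) \<omega> = 0 - 0"
      using real_cond_exp_F_meas[of "\<lambda>_. 0"] by simp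
  qed (auto simp: adapted_def)
  show "AE \<omega> in M. incseq (\<lambda>n. of_nat n :: ennreal) \<and> (\<lambda>n. of_nat n :: ennreal) \<longlonglongrightarrow> \<infinity>"
    using of_nat_tendsto_top_ennreal by (auto simp: incseq_def)
qed (auto simp: adapted_def cadlag_def stopping_time_ext_def stopping_time_const intro!: exI[of _ 0])

text \<open>The process is its own finite-variation part, with zero local martingale part; starting
  at 0 makes this decomposition admissible.\<close>

lemma semimartingale_of_continuously_differentiable:
  assumes "prob_space M" and F: "filtration_on M F" "adapted F X"
    and X: "\<And>\<omega>. \<omega> \<in> space M \<Longrightarrow> continuously_differentiable_path (\<lambda>t. X t \<omega>)"
    and 0: "\<And>\<omega>. \<omega> \<in> space M \<Longrightarrow> X 0 \<omega> = 0"
  shows "semimartingale M F X"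
  unfolding semimartingale_def
  using assms local_martingale_zero[of M F] continuously_differentiable_path_cadlag
    continuously_differentiable_path_finite_variation
  by (intro conjI exI[of _ "\<lambda>_ _. 0"] exI[of _ X]) auto

section \<open>Properties of negative sub-fractional Brownian motion\<close>

theorem proposition3p4:
  fixes M :: "'a measure" and h :: real and \<zeta> \<theta> :: "real \<Rightarrow> 'a \<Rightarrow> real"
  assumes "2 < h" and "h < 4"
    and "prob_space M"
    and "neg_sub_fBm M h \<zeta>"
    and "centered_gaussian_process M \<theta>"
    and "has_covariance M \<theta> (\<lambda>s t. (s + t) powr (h - 2) - \<bar>s - t\<bar> powr (h - 2))"
    and "\<forall>\<omega>\<in>space M. continuous_on {0..} (\<lambda>t. \<theta> t \<omega>)"
    and "\<forall>t\<ge>0. \<forall>\<omega>\<in>space M.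
           \<zeta> t \<omega> = sqrt (1 / 2 * h * (h - 1) * (h - 2)) * integral {0..t} (\<lambda>s. \<theta> s \<omega>)"
  shows
    "((\<forall>\<omega>\<in>space M. continuously_differentiable_path (\<lambda>t. \<zeta> t \<omega>)) \<and>
      semimartingale M (natural_filtration M \<zeta>) \<zeta>) \<and>
     (\<forall>c>0. fdd_eq M (\<lambda>t. \<zeta> (c * t)) M (\<lambda>t \<omega>. c powr (h / 2) * \<zeta> t \<omega>)) \<and>
     ((\<forall>T>0. \<exists>C::real. \<forall>s t. 0 \<le> s \<and> s < t \<and> t \<le> T \<longrightarrow>
          (\<integral>\<omega>. (\<zeta> t \<omega> - \<zeta> s \<omega>)\<^sup>2 \<partial>M) \<le> C * \<bar>t - s\<bar>\<^sup>2) \<and>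
      (\<forall>\<epsilon>>0. \<exists>C>0. \<forall>s t. \<epsilon> \<le> s \<and> s < t \<longrightarrow>
          (\<integral>\<omega>. (\<zeta> t \<omega> - \<zeta> s \<omega>)\<^sup>2 \<partial>M) \<ge> C * \<bar>t - s\<bar>\<^sup>2) \<and>
      (\<exists>C>0. \<forall>s t. 0 \<le> s \<and> 0 \<le> t \<longrightarrow>
          (\<integral>\<omega>. (\<zeta> t \<omega> - \<zeta> s \<omega>)\<^sup>2 \<partial>M) \<ge> C * \<bar>t - s\<bar> powr h)) \<and>
     (\<forall>r v s t. 0 \<le> r \<and> r < v \<and> 0 \<le> s \<and> s < t \<longrightarrow>
        (\<integral>\<omega>. (\<zeta> v \<omega> - \<zeta> r \<omega>) * (\<zeta> t \<omega> - \<zeta> s \<omega>) \<partial>M) > 0) \<and>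
     (\<forall>r v s t. 0 \<le> r \<and> r < v \<and> v \<le> s \<and> s < t \<longrightarrow>
        ((\<lambda>T. T powr (3 - h) *
              (\<integral>\<omega>. (\<zeta> v \<omega> - \<zeta> r \<omega>) * (\<zeta> (t + T) \<omega> - \<zeta> (s + T) \<omega>) \<partial>M))
          \<longlongrightarrow> h * (h - 1) * (h - 2)\<^sup>2 / 2 * (t - s) * (v\<^sup>2 - r\<^sup>2)) at_top) \<and>
     \<not> markov_process M (natural_filtration M \<zeta>) \<zeta>"
proof -
  note h = assms(1,2)
  interpret prob_space M by fact
  let ?R = "incr_var h"
  have cov: "has_covariance M \<zeta> (\<lambda>s t. (h - 2) * ?R s t)"
    unfolding has_covariance_def
  proof (intro allI impI)
    fix s t :: real assume "0 \<le> s" "0 \<le> t"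
    then have "(\<integral>\<omega>. \<zeta> s \<omega> * \<zeta> t \<omega> \<partial>M) = (2 - h) * (s powr h + t powr h - 1 / 2 * ((s + t) powr h + \<bar>s - t\<bar> powr h))"
      using assms(4) by (simp add: neg_sub_fBm_def has_covariance_def)
    also have "\<dots> = (h - 2) * ?R s t"
      using \<open>0 \<le> s\<close> \<open>0 \<le> t\<close> by (simp add: incr_var_def pow_sum_def field_simps)
    finally show "(\<integral>\<omega>. \<zeta> s \<omega> * \<zeta> t \<omega> \<partial>M) = (h - 2) * ?R s t" .
  qed
  interpret centered_gaussian M \<zeta> "\<lambda>s t. (h - 2) * ?R s t"
    by unfold_locales (use assms(4) cov in \<open>auto simp: neg_sub_fBm_def\<close>)
  have var: "(\<integral>\<omega>. (\<zeta> t \<omega> - \<zeta> s \<omega>)\<^sup>2 \<partial>M) = (h - 2) * ?R (s + t) (t - s)" if "s \<ge> 0" "t \<ge> 0" for s t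
    using cov_increments[of s t s t] that
    by (simp add: power2_eq_square incr_var_increment[symmetric] algebra_simps)
  have mixed: "(\<integral>\<omega>. (\<zeta> v \<omega> - \<zeta> r \<omega>) * (\<zeta> t \<omega> - \<zeta> s \<omega>) \<partial>M)
      = (h - 2) / 2 * (pow_sum h v t - pow_sum h v s - pow_sum h r t + pow_sum h r s)"
    if "r \<ge> 0" "v \<ge> 0" "s \<ge> 0" "t \<ge> 0" for r v s t
  proof -
    have "(\<integral>\<omega>. (\<zeta> v \<omega> - \<zeta> r \<omega>) * (\<zeta> t \<omega> - \<zeta> s \<omega>) \<partial>M)
        = (h - 2) * (?R v t - ?R v s - ?R r t + ?R r s)"
      using cov_increments[of r v s t] that by (simp add: algebra_simps)
    then show ?thesis by (simp add: incr_var_mixed)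
  qed
  have paths: "continuously_differentiable_path (\<lambda>t. \<zeta> t \<omega>)" if "\<omega> \<in> space M" for \<omega>
    using assms(7,8) that
    by (intro continuously_differentiable_path_integral[of "\<lambda>s. \<theta> s \<omega>" _ "sqrt (1 / 2 * h * (h - 1) * (h - 2))"]) auto
  have semi: "semimartingale M (natural_filtration M \<zeta>) \<zeta>"
    \<comment> \<open>At time 0 the path integral runs over a single point, so the process starts at
      0.\<close>
    using assms(8) by (intro semimartingale_of_continuously_differentiable prob_space_axioms
        filtration_on_natural_filtration adapted_natural_filtration measurable_X paths) auto
  have selfsim: "fdd_eq M (\<lambda>t. \<zeta> (c * t)) M (\<lambda>t \<omega>. c powr (h / 2) * \<zeta> t \<omega>)" if c: "c > 0" for c
  proof -
    \<comment> \<open>R is homogeneous of degree h, so scaling time by c and space by c^(h / 2)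
      gives the same covariance.\<close>
    have "(c powr (h / 2))\<^sup>2 = c powr h" by (simp add: power2_eq_square flip: powr_add)
    then have "(\<lambda>s t. (c powr (h / 2))\<^sup>2 * ((h - 2) * ?R s t)) = (\<lambda>s t. (h - 2) * ?R (c * s) (c * t))"
      using c by (simp add: incr_var_scale mult.left_commute)
    with space_scaled[of "c powr (h / 2)"]
    have "centered_gaussian M (\<lambda>t \<omega>. c powr (h / 2) * \<zeta> t \<omega>) (\<lambda>s t. (h - 2) * ?R (c * s) (c * t))"
      by simp
    then show ?thesis
      by (rule centered_gaussian.fdd_eq_cong[OF time_scaled[OF c]])
  qed
  have upper: "\<exists>C::real. \<forall>s t. 0 \<le> s \<and> s < t \<and> t \<le> T \<longrightarrow> (\<integral>\<omega>. (\<zeta> t \<omega> - \<zeta> s \<omega>)\<^sup>2 \<partial>M) \<le> C * \<bar>t - s\<bar>\<^sup>2" for T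
  proof (intro exI allI impI)
    fix s t assume st: "0 \<le> s \<and> s < t \<and> t \<le> T"
    then have "?R (s + t) (t - s) \<le> h * (h - 1) * (4 * T) powr (h - 2) * (t - s)\<^sup>2"
      by (intro incr_var_upper h) auto
    from mult_left_mono[OF this, of "h - 2"] h
    show "(\<integral>\<omega>. (\<zeta> t \<omega> - \<zeta> s \<omega>)\<^sup>2 \<partial>M) \<le> (h - 2) * (h * (h - 1) * (4 * T) powr (h - 2)) * \<bar>t - s\<bar>\<^sup>2"
      using st by (simp add: var mult.assoc)
  qed
  have lower: "\<exists>C>0. \<forall>s t. \<epsilon> \<le> s \<and> s < t \<longrightarrow> (\<integral>\<omega>. (\<zeta> t \<omega> - \<zeta> s \<omega>)\<^sup>2 \<partial>M) \<ge> C * \<bar>t - s\<bar>\<^sup>2" if \<epsilon>: "\<epsilon> > 0" for \<epsilon>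
  proof -
    obtain C where C: "C > 0" "\<And>m d. 0 \<le> d \<Longrightarrow> d + \<epsilon> \<le> m \<Longrightarrow> C * d\<^sup>2 \<le> ?R m d"
      using incr_var_lower_away_from_0[OF h(1) \<epsilon>] by blast
    show ?thesis
    proof (intro exI[of _ "(h - 2) * C"] conjI allI impI)
      show "(h - 2) * C > 0" using C h by simp
      fix s t assume st: "\<epsilon> \<le> s \<and> s < t"
      \<comment> \<open>With m = s + t and d = t - s the gap m - d is 2 s, which exceeds
        \<epsilon>.\<close>
      then have "C * (t - s)\<^sup>2 \<le> ?R (s + t) (t - s)" using \<epsilon> by (intro C) auto
      from mult_left_mono[OF this, of "h - 2"] h
      show "(\<integral>\<omega>. (\<zeta> t \<omega> - \<zeta> s \<omega>)\<^sup>2 \<partial>M) \<ge> (h - 2) * C * \<bar>t - s\<bar>\<^sup>2"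
        using st \<epsilon> by (simp add: var mult.assoc)
    qed
  qed
  have lower_h: "\<exists>C>0. \<forall>s t. 0 \<le> s \<and> 0 \<le> t \<longrightarrow> (\<integral>\<omega>. (\<zeta> t \<omega> - \<zeta> s \<omega>)\<^sup>2 \<partial>M) \<ge> C * \<bar>t - s\<bar> powr h"
  proof (intro exI[of _ "(h - 2) * (2 powr (h - 1) - 2)"] conjI allI impI)
    have "2 powr 1 < (2::real) powr (h - 1)" using h by (intro powr_less_mono) auto
    then show "(h - 2) * (2 powr (h - 1) - 2) > 0" using h by simp
    have le: "(h - 2) * (2 powr (h - 1) - 2) * \<bar>t - s\<bar> powr h \<le> (\<integral>\<omega>. (\<zeta> t \<omega> - \<zeta> s \<omega>)\<^sup>2 \<partial>M)"
      if st: "0 \<le> s" "s \<le> t" for s t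
    proof -
      have "(2 powr (h - 1) - 2) * (t - s) powr h \<le> ?R (s + t) (t - s)"
        using st by (intro incr_var_lower_diagonal h) auto
      from mult_left_mono[OF this, of "h - 2"] h show ?thesis using st by (simp add: var mult.assoc)
    qed
    fix s t :: real assume st: "0 \<le> s \<and> 0 \<le> t"
    show "(\<integral>\<omega>. (\<zeta> t \<omega> - \<zeta> s \<omega>)\<^sup>2 \<partial>M) \<ge> (h - 2) * (2 powr (h - 1) - 2) * \<bar>t - s\<bar> powr h"
      using le[of s t] le[of t s] st by (cases "s \<le> t") (auto simp: abs_minus_commute power2_commute)
  qed
  have pos: "(\<integral>\<omega>. (\<zeta> v \<omega> - \<zeta> r \<omega>) * (\<zeta> t \<omega> - \<zeta> s \<omega>) \<partial>M) > 0"
    if "0 \<le> r \<and> r < v \<and> 0 \<le> s \<and> s < t" for r v s t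
    using pow_sum_supermodular[OF h(1), of r v s t] that h by (simp add: mixed)
  have lim: "((\<lambda>T. T powr (3 - h) * (\<integral>\<omega>. (\<zeta> v \<omega> - \<zeta> r \<omega>) * (\<zeta> (t + T) \<omega> - \<zeta> (s + T) \<omega>) \<partial>M))
      \<longlongrightarrow> h * (h - 1) * (h - 2)\<^sup>2 / 2 * (t - s) * (v\<^sup>2 - r\<^sup>2)) at_top"
    if "0 \<le> r \<and> r < v \<and> v \<le> s \<and> s < t" for r v s t
  proof (rule Lim_transform_eventually)
    show "((\<lambda>T. (h - 2) / 2 * (T powr (3 - h) * (pow_sum h v (t + T) - pow_sum h v (s + T) - pow_sum h r (t + T) + pow_sum h r (s + T))))
        \<longlongrightarrow> h * (h - 1) * (h - 2)\<^sup>2 / 2 * (t - s) * (v\<^sup>2 - r\<^sup>2)) at_top"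
      by (rule tendsto_eq_intros pow_sum_mixed_difference_limit refl)+ (simp add: power2_eq_square)
    show "eventually (\<lambda>T. (h - 2) / 2 * (T powr (3 - h) * (pow_sum h v (t + T) - pow_sum h v (s + T) - pow_sum h r (t + T) + pow_sum h r (s + T)))
        = T powr (3 - h) * (\<integral>\<omega>. (\<zeta> v \<omega> - \<zeta> r \<omega>) * (\<zeta> (t + T) \<omega> - \<zeta> (s + T) \<omega>) \<partial>M)) at_top"
      using eventually_ge_at_top[of 0] by eventually_elim (use that in \<open>simp add: mixed\<close>)
  qed
  have "\<not> markov_process M (natural_filtration M \<zeta>) \<zeta>"
  proof
    assume markov: "markov_process M (natural_filtration M \<zeta>) \<zeta>"
    obtain r t where rt: "0 < r" "r < 1" "1 < t" "?R r t * ?R 1 1 \<noteq> ?R r 1 * ?R 1 t"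
      using incr_var_not_multiplicative[OF h] by blast
    \<comment> \<open>The Markov identity at s = 1 carries (h - 2)^2 on both sides; this factor is
      nonzero and cancels.\<close>
    then show False
      using markov_covariance[OF markov, of r 1 t] h by simp
  qed
  then show ?thesis
    using paths semi selfsim upper lower lower_h pos lim by blast
qed

end
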